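(* Let $K$ be an algebraically closed field of characteristic other than $2$ and let $\mathfrak p$ be the Poincaré algebra over $K$. Consider the short exact sequence of Lie algebras $$0\to K\times K^4\to\mathrm{Der}(\mathfrak p)\xrightarrow{\,q\,}\mathrm{Der}(\mathfrak o_4(K))\to0,$$ where the first map is $(\lambda,v_0)\mapsto d_{\lambda,v_0}$. This sequence is split: there is a Lie algebra monomorphism $j\colon\mathrm{Der}(\mathfrak o_4(K))\to\mathrm{Der}(\mathfrak p)$ such that, for $\alpha=\mathrm{ad}(x_0)\in\mathrm{Der}(\mathfrak o_4(K))$ with $x_0\in\mathfrak o_4(K)$, $$j(\alpha)\colon\begin{pmatrix}0&v\\0&x\end{pmatrix}\mapsto\begin{pmatrix}0&-vx_0\\0&\alpha(x)\end{pmatrix},$$ and it satisfies $q\circ j=1$. Consequently any derivation $d\in\mathrm{Der}(\mathfrak p)$ can be uniquely written as a sum $j(\alpha)+d_{\lambda,v_0}$ with $\alpha\in\mathrm{Der}(\mathfrak o_4(K))$ and $(\lambda,v_0)\in K\times K^4$. Furthermore: (1) $\{d_{\lambda,v_0}:(\lambda,v_0)\in K\times K^4\}\cong K\times K^4$ is the (solvable) radical $\mathfrak R$ of $\mathrm{Der}(\mathfrak p)$; (2) $\mathrm{Der}(\mathfrak p)=\mathfrak R\oplus j(\mathrm{Der}(\mathfrak o_4(K)))$ as a direct sum of vector subspaces, with $j(\mathrm{Der}(\mathfrak o_4(K)))\cong\mathfrak{sl}_2(K)^2$ as Lie algebras.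
   Context: $\mathfrak o_4(K)$ is the Lie algebra of skew-symmetric $4\times4$ matrices over $K$; under the present hypotheses all its derivations are inner. Vectors in $K^4$ are row vectors. The Poincaré algebra is $$\mathfrak p=\left\{\begin{pmatrix}0&v\\0&M\end{pmatrix}: v\in K^4,\ M\in\mathfrak o_4(K)\right\},\qquad \left[\begin{pmatrix}0&v\\0&M\end{pmatrix},\begin{pmatrix}0&v'\\0&M'\end{pmatrix}\right]=\begin{pmatrix}0&vM'-v'M\\0&[M,M']\end{pmatrix}.$$ The map $q\colon\mathrm{Der}(\mathfrak p)\to\mathrm{Der}(\mathfrak o_4(K))$ is $q(d)=\pi\circ d\circ i$, where $i\colon M\mapsto\begin{pmatrix}0&0\\0&M\end{pmatrix}$ and $\pi\colon\begin{pmatrix}0&v\\0&M\end{pmatrix}\mapsto M$. The space $K\times K^4$ carries the Lie bracket $[(\lambda,v_0),(\lambda',v_0')]=(0,\lambda v_0'-\lambda'v_0)$. For $(\lambda,v_0)\in K\times K^4$, $d_{\lambda,v_0}\in\mathrm{Der}(\mathfrak p)$ is $$d_{\lambda,v_0}\begin{pmatrix}0&v\\0&x\end{pmatrix}=\begin{pmatrix}0&\lambda v+v_0x\\0&0\end{pmatrix}.$$ *)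

theory Defs
  imports
    "HOL-Analysis.Analysis"
    "HOL-Computational_Algebra.Computational_Algebra"
    "HOL-Library.Function_Algebras"
begin

section \<open>Lie algebras\<close>

text \<open>
  A Lie algebra over a field is carried by a linear subspace of an ambient vector space, which
  consists of all elements of the type \<^typ>\<open>'v\<close>; \<open>scl\<close> is the scalar multiplication of the ambient
  space, whose addition is that of the type. The bracket matters on the carrier only.
\<close>

record ('k, 'v) lie_alg =
  carr :: "'v set"
  scl :: "'k \<Rightarrow> 'v \<Rightarrow> 'v"
  brk :: "'v \<Rightarrow> 'v \<Rightarrow> 'v"

locale lie_algebra = vector_space "scl L"
  for L :: "('k::field, 'v::ab_group_add) lie_alg" +
  assumes subspace_carr: "subspace (carr L)"
    and brk_closed: "\<lbrakk>x \<in> carr L; y \<in> carr L\<rbrakk> \<Longrightarrow> brk L x y \<in> carr L"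
    and brk_add_left:
      "\<lbrakk>x \<in> carr L; y \<in> carr L; z \<in> carr L\<rbrakk> \<Longrightarrow> brk L (x + y) z = brk L x z + brk L y z"
    and brk_add_right:
      "\<lbrakk>x \<in> carr L; y \<in> carr L; z \<in> carr L\<rbrakk> \<Longrightarrow> brk L x (y + z) = brk L x y + brk L x z"
    and brk_scl_left: "\<lbrakk>x \<in> carr L; y \<in> carr L\<rbrakk> \<Longrightarrow> brk L (scl L c x) y = scl L c (brk L x y)"
    and brk_scl_right: "\<lbrakk>x \<in> carr L; y \<in> carr L\<rbrakk> \<Longrightarrow> brk L x (scl L c y) = scl L c (brk L x y)"
    and brk_self: "x \<in> carr L \<Longrightarrow> brk L x x = 0"
    and jacobi: "\<lbrakk>x \<in> carr L; y \<in> carr L; z \<in> carr L\<rbrakk> \<Longrightarrow>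
      brk L x (brk L y z) + brk L y (brk L z x) + brk L z (brk L x y) = 0"

definition linear_map_on ::
    "('k::field, 'v::ab_group_add) lie_alg \<Rightarrow> ('k, 'w::ab_group_add) lie_alg \<Rightarrow> ('v \<Rightarrow> 'w) \<Rightarrow> bool"
  where "linear_map_on L M f \<longleftrightarrow>
    (\<forall>x\<in>carr L. f x \<in> carr M) \<and>
    (\<forall>x\<in>carr L. \<forall>y\<in>carr L. f (x + y) = f x + f y) \<and>
    (\<forall>c. \<forall>x\<in>carr L. f (scl L c x) = scl M c (f x))"

definition lie_hom ::
    "('k::field, 'v::ab_group_add) lie_alg \<Rightarrow> ('k, 'w::ab_group_add) lie_alg \<Rightarrow> ('v \<Rightarrow> 'w) \<Rightarrow> bool"
  where "lie_hom L M f \<longleftrightarrow> lie_algebra L \<and> lie_algebra M \<and> linear_map_on L M f \<and>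
    (\<forall>x\<in>carr L. \<forall>y\<in>carr L. f (brk L x y) = brk M (f x) (f y))"

definition lie_mono ::
    "('k::field, 'v::ab_group_add) lie_alg \<Rightarrow> ('k, 'w::ab_group_add) lie_alg \<Rightarrow> ('v \<Rightarrow> 'w) \<Rightarrow> bool"
  where "lie_mono L M f \<longleftrightarrow> lie_hom L M f \<and> inj_on f (carr L)"

definition lie_isomorphic ::
    "('k::field, 'v::ab_group_add) lie_alg \<Rightarrow> ('k, 'w::ab_group_add) lie_alg \<Rightarrow> bool"
  where "lie_isomorphic L M \<longleftrightarrow> (\<exists>f. lie_hom L M f \<and> bij_betw f (carr L) (carr M))"

definition short_exact ::
    "('k::field, 'u::ab_group_add) lie_alg \<Rightarrow> ('k, 'v::ab_group_add) lie_alg \<Rightarrow>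
     ('k, 'w::ab_group_add) lie_alg \<Rightarrow> ('u \<Rightarrow> 'v) \<Rightarrow> ('v \<Rightarrow> 'w) \<Rightarrow> bool"
  where "short_exact A B C f g \<longleftrightarrow>
    lie_mono A B f \<and> lie_hom B C g \<and>
    f ` carr A = {x \<in> carr B. g x = 0} \<and> g ` carr B = carr C"

definition lie_prod ::
    "('k::field, 'v::ab_group_add) lie_alg \<Rightarrow> ('k, 'w::ab_group_add) lie_alg \<Rightarrow>
     ('k, 'v \<times> 'w) lie_alg"
  where "lie_prod L M =
    \<lparr>carr = carr L \<times> carr M,
     scl = (\<lambda>c (x, y). (scl L c x, scl M c y)),
     brk = (\<lambda>(x, y) (x', y'). (brk L x x', brk M y y'))\<rparr>"

text \<open>
  Derivations are maps \<open>'v \<Rightarrow> 'v\<close>, of which only the restriction to the carrier is relevant; to make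
  equality of derivations the equality of maps, they are required to vanish off the carrier. All
  operations below respect this normalisation.
\<close>

definition Der :: "('k::field, 'v::ab_group_add) lie_alg \<Rightarrow> ('k, 'v \<Rightarrow> 'v) lie_alg"
  where "Der L =
    \<lparr>carr = {d. linear_map_on L L d \<and>
        (\<forall>x\<in>carr L. \<forall>y\<in>carr L. d (brk L x y) = brk L (d x) y + brk L x (d y)) \<and>
        (\<forall>x. x \<notin> carr L \<longrightarrow> d x = 0)},
     scl = (\<lambda>c d x. scl L c (d x)),
     brk = (\<lambda>d e x. d (e x) - e (d x))\<rparr>"

definition ad :: "('k::field, 'v::ab_group_add) lie_alg \<Rightarrow> 'v \<Rightarrow> 'v \<Rightarrow> 'v"
  where "ad L x = (\<lambda>y. if y \<in> carr L then brk L x y else 0)"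

definition lie_ideal :: "('k::field, 'v::ab_group_add) lie_alg \<Rightarrow> 'v set \<Rightarrow> bool"
  where "lie_ideal L I \<longleftrightarrow> I \<subseteq> carr L \<and> module.subspace (scl L) I \<and>
    (\<forall>x\<in>carr L. \<forall>y\<in>I. brk L x y \<in> I)"

primrec derived_series ::
    "('k::field, 'v::ab_group_add) lie_alg \<Rightarrow> 'v set \<Rightarrow> nat \<Rightarrow> 'v set"
  where
    "derived_series L S 0 = S"
  | "derived_series L S (Suc n) = module.span (scl L)
      {brk L x y | x y. x \<in> derived_series L S n \<and> y \<in> derived_series L S n}"

definition solvable_ideal :: "('k::field, 'v::ab_group_add) lie_alg \<Rightarrow> 'v set \<Rightarrow> bool"
  where "solvable_ideal L I \<longleftrightarrow> lie_ideal L I \<and> (\<exists>n. derived_series L I n = {0})"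

text \<open>The solvable radical is the largest solvable ideal.\<close>

definition is_radical :: "('k::field, 'v::ab_group_add) lie_alg \<Rightarrow> 'v set \<Rightarrow> bool"
  where "is_radical L R \<longleftrightarrow> solvable_ideal L R \<and> (\<forall>I. solvable_ideal L I \<longrightarrow> I \<subseteq> R)"

definition direct_sum_of ::
    "('k::field, 'v::ab_group_add) lie_alg \<Rightarrow> 'v set \<Rightarrow> 'v set \<Rightarrow> bool"
  where "direct_sum_of L U W \<longleftrightarrow> module.subspace (scl L) U \<and> module.subspace (scl L) W \<and>
    U \<inter> W = {0} \<and> carr L = {u + w | u w. u \<in> U \<and> w \<in> W}"


section \<open>The matrix Lie algebras\<close>

definition matrix_lie :: "('a::field^'n^'n) set \<Rightarrow> ('a, 'a^'n^'n) lie_alg"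
  where "matrix_lie S =
    \<lparr>carr = S,
     scl = (\<lambda>c A. \<chi> i. c *s (A $ i)),
     brk = (\<lambda>A B. A ** B - B ** A)\<rparr>"

definition o4 :: "('a::field, 'a^4^4) lie_alg"
  where "o4 = matrix_lie {M. transpose M = - M}"

definition sl2 :: "('a::field, 'a^2^2) lie_alg"
  where "sl2 = matrix_lie {M. trace M = 0}"

text \<open>
  The rows and columns of a block matrix are indexed by the disjoint sum \<^typ>\<open>1 + 4\<close>:
  \<open>block v M\<close> has the rows \<open>(0, v)\<close> and \<open>(0, M)\<close>.
\<close>

type_synonym 'a mat5 = "'a^(1 + 4)^(1 + 4)"

definition block :: "'a::field^4 \<Rightarrow> 'a^4^4 \<Rightarrow> 'a mat5"
  where "block v M = (\<chi> r c. case c of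
      Inl _ \<Rightarrow> 0
    | Inr k \<Rightarrow> (case r of Inl _ \<Rightarrow> v $ k | Inr i \<Rightarrow> M $ i $ k))"

definition row_part :: "'a::field mat5 \<Rightarrow> 'a^4"
  where "row_part X = (\<chi> k. X $ Inl 1 $ Inr k)"

definition mat_part :: "'a::field mat5 \<Rightarrow> 'a^4^4"
  where "mat_part X = (\<chi> i k. X $ Inr i $ Inr k)"

lemma row_part_block [simp]: "row_part (block v M) = v"
  by (simp add: row_part_def block_def vec_eq_iff)

lemma mat_part_block [simp]: "mat_part (block v M) = M"
  by (simp add: mat_part_def block_def vec_eq_iff)

definition poincare :: "('a::field, 'a mat5) lie_alg"
  where "poincare = matrix_lie {block v M | v M. M \<in> carr o4}"

lemma brk_poincare_block:
  "brk poincare (block v M) (block v' M') = block (v v* M' - v' v* M) (brk o4 M M')"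
proof -
  have *: "(\<Sum>x\<in>(UNIV::(1 + 4) set). f x) = f (Inl 1) + (\<Sum>i\<in>UNIV. f (Inr i))"
    for f :: "1 + 4 \<Rightarrow> 'a"
  proof -
    have "(\<Sum>x\<in>(UNIV::(1 + 4) set). f x) = (\<Sum>i\<in>UNIV. f (Inl i)) + (\<Sum>i\<in>UNIV. f (Inr i))"
      by (subst UNIV_Plus_UNIV [symmetric], subst sum.Plus) (simp_all)
    then show ?thesis
      by simp
  qed
  show ?thesis
    by (simp add: poincare_def o4_def matrix_lie_def vec_eq_iff block_def matrix_matrix_mult_def
        vector_matrix_mult_def * split: sum.split)
qed


section \<open>The maps between the derivation algebras\<close>

text \<open>The space \<open>K \<times> K\<^sup>4\<close>.\<close>

definition scal_vec :: "('a::field, 'a \<times> ('a^4)) lie_alg"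
  where "scal_vec =
    \<lparr>carr = UNIV,
     scl = (\<lambda>c (l, v). (c * l, c *s v)),
     brk = (\<lambda>(l, v) (l', v'). (0, l *s v' - l' *s v))\<rparr>"

definition dmap :: "'a::field \<times> ('a^4) \<Rightarrow> 'a mat5 \<Rightarrow> 'a mat5"
  where "dmap = (\<lambda>(l, v0) X.
    if X \<in> carr poincare then block (l *s row_part X + v0 v* mat_part X) 0 else 0)"

definition qmap :: "('a::field mat5 \<Rightarrow> 'a mat5) \<Rightarrow> 'a^4^4 \<Rightarrow> 'a^4^4"
  where "qmap d = mat_part \<circ> d \<circ> block 0"

end

(*
  Derivations of the Poincare algebra preserve the translation ideal V = K^4: the projection of a
  derivation restricted to V is an equivariant map from V to o4, and it vanishes because the
  stabiliser so3 of a coordinate vector has trivial centraliser in o4. If the induced derivation of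
  o4 vanishes as well, what is left is a scalar on V (equivariance) and a cocycle from o4 to V,
  which is a coboundary; this is the kernel of q. The algebra o4 is the sum of its self-dual and
  anti-self-dual parts, both isomorphic to K^3 with the cross product, that is to sl2 once
  -1 has a square root. In these coordinates all derivations are seen to be inner, and every
  nonzero ideal contains one of the two parts, which is perfect; hence solvable ideals of Der p
  lie in the kernel of q. Since the derivations of o4 are inner, sending ad x to the inner
  derivation of x in the Poincare algebra splits the sequence. In characteristic 2, where "skew"
  means "symmetric", the identity matrix lies in o4 and acts on V as a scalar, which replaces the
  arguments on the kernel of q; an ideal of o4 which contains a non-scalar matrix contains all
  symmetric matrices with zero diagonal, and these form a perfect algebra.
*)

theory Submission
  imports Defs
begin

no_notation fps_nth (infixl "$" 75)

section \<open>Lie algebras and their derivations\<close>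

text \<open>The obstacle is that the inclusion of solvable ideals in the kernel of q has to cover
  characteristic 2, whereas "all derivations of \<open>o4\<close> are inner" and "q is onto" are
  established only where 2 is nonzero. So the passage from a solvable ideal I of Der(p) to an ideal
  of \<open>o4\<close> does not lift derivations of \<open>o4\<close>. It uses the ideal J of all x
  in \<open>o4\<close> with ad(x) in q(I), together with the identity [d, ad X] = ad(d X), which
  places q(d)(x) in J for every d in I and every x in \<open>o4\<close>. A non-scalar element of J
  would give a nonzero perfect set inside q(I), against solvability; hence q(d) takes scalar values
  only. Where 2 is nonzero, the only scalar matrix in \<open>o4\<close> is 0 and this ends the
  argument; in characteristic 2 the scalars are central, and it is the action of d on the
  translations that excludes them. Both cases are run through the same statements.\<close>

lemma lie_algebra_subalgebra:
  fixes L :: "('k::field, 'v::ab_group_add) lie_alg"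
  assumes "lie_algebra L" "module.subspace (scl L) S" "S \<subseteq> carr L"
    and "\<And>x y. \<lbrakk>x \<in> S; y \<in> S\<rbrakk> \<Longrightarrow> brk L x y \<in> S"
  shows "lie_algebra (L\<lparr>carr := S\<rparr>)"
proof -
  interpret lie_algebra L by fact
  note sub = subsetD [OF assms(3)]
  show ?thesis
  proof (intro lie_algebra.intro lie_algebra_axioms.intro)
    show "vector_space (scl (L\<lparr>carr := S\<rparr>))"
      using vector_space_axioms by simp
  qed (use assms(2,4) in \<open>simp_all add: sub brk_add_left brk_add_right brk_scl_left brk_scl_right
        brk_self jacobi\<close>)
qed

lemma linear_map_on_zero:
  assumes "lie_algebra L" "lie_algebra M" "linear_map_on L M f"
  shows "f 0 = 0"
proof -
  interpret L: lie_algebra L by fact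
  interpret M: lie_algebra M by fact
  have "0 \<in> carr L"
    by (rule L.subspace_0 [OF L.subspace_carr])
  then have "f (0 + 0) = f 0 + f 0"
    using assms(3) unfolding linear_map_on_def by blast
  then show ?thesis
    by simp
qed

lemma linear_map_on_diff:
  assumes "lie_algebra L" "lie_algebra M" "linear_map_on L M f" "x \<in> carr L" "y \<in> carr L"
  shows "f (x - y) = f x - f y"
proof -
  interpret L: lie_algebra L by fact
  have "x - y \<in> carr L"
    by (rule L.subspace_diff [OF L.subspace_carr assms(4,5)])
  then have "f ((x - y) + y) = f (x - y) + f y"
    using assms(3,5) unfolding linear_map_on_def by blast
  then show ?thesis
    by simp
qed

context lie_algebra
begin

lemma carr_0: "0 \<in> carr L"
  by (rule subspace_0 [OF subspace_carr])

lemma carr_add: "\<lbrakk>x \<in> carr L; y \<in> carr L\<rbrakk> \<Longrightarrow> x + y \<in> carr L"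
  by (rule subspace_add [OF subspace_carr])

lemma carr_diff: "\<lbrakk>x \<in> carr L; y \<in> carr L\<rbrakk> \<Longrightarrow> x - y \<in> carr L"
  by (rule subspace_diff [OF subspace_carr])

lemma carr_uminus: "x \<in> carr L \<Longrightarrow> - x \<in> carr L"
  using carr_diff [OF carr_0] by simp

lemma carr_scl: "x \<in> carr L \<Longrightarrow> scl L c x \<in> carr L"
  by (rule subspace_scale [OF subspace_carr])

lemma brk_zero_left: "y \<in> carr L \<Longrightarrow> brk L 0 y = 0"
  using brk_add_left [of 0 0 y] carr_0 by simp

lemma brk_zero_right: "y \<in> carr L \<Longrightarrow> brk L y 0 = 0"
  using brk_add_right [of y 0 0] carr_0 by simp

lemma brk_anticomm:
  assumes "x \<in> carr L" "y \<in> carr L"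
  shows "brk L y x = - brk L x y"
proof -
  have "brk L (x + y) (x + y) = brk L x y + brk L y x"
    using assms by (simp add: brk_add_left brk_add_right carr_add brk_self [of x] brk_self [of y])
  then show ?thesis
    using brk_self [OF carr_add [OF assms]] by (simp add: eq_neg_iff_add_eq_0 add.commute)
qed

lemma brk_uminus_right:
  assumes "x \<in> carr L" "y \<in> carr L"
  shows "brk L x (- y) = - brk L x y"
  using brk_add_right [of x y "- y"] assms carr_uminus brk_zero_right
  by (simp add: eq_neg_iff_add_eq_0 add.commute)

lemma brk_diff_left:
  assumes "x \<in> carr L" "y \<in> carr L" "z \<in> carr L"
  shows "brk L (x - y) z = brk L x z - brk L y z"
  using brk_add_left [of "x - y" y z] assms carr_diff by simp

lemma brk_diff_right:
  assumes "x \<in> carr L" "y \<in> carr L" "z \<in> carr L"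
  shows "brk L z (x - y) = brk L z x - brk L z y"
  using brk_add_right [of z "x - y" y] assms carr_diff by simp

text \<open>This form of the Jacobi identity says that bracketing with x is a derivation, and
  equally that \<open>ad\<close> turns brackets into commutators.\<close>

lemma leibniz:
  assumes "x \<in> carr L" "y \<in> carr L" "z \<in> carr L"
  shows "brk L x (brk L y z) = brk L (brk L x y) z + brk L y (brk L x z)"
proof -
  have "brk L (brk L x y) z = - brk L z (brk L x y)"
    using assms brk_closed brk_anticomm by blast
  moreover have "brk L y (brk L x z) = - brk L y (brk L z x)"
    using assms brk_closed by (simp add: brk_anticomm [of z x] brk_uminus_right)
  ultimately show ?thesis
    using jacobi [OF assms] by (simp add: add_eq_0_iff2 add.assoc)
qed

end

lemma Der_simps:
  "scl (Der L) = (\<lambda>c d x. scl L c (d x))" "brk (Der L) = (\<lambda>d e x. d (e x) - e (d x))"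
  by (simp_all add: Der_def)

lemma Der_iff:
  "d \<in> carr (Der L) \<longleftrightarrow>
    (\<forall>x\<in>carr L. d x \<in> carr L) \<and>
    (\<forall>x\<in>carr L. \<forall>y\<in>carr L. d (x + y) = d x + d y) \<and>
    (\<forall>c. \<forall>x\<in>carr L. d (scl L c x) = scl L c (d x)) \<and>
    (\<forall>x\<in>carr L. \<forall>y\<in>carr L. d (brk L x y) = brk L (d x) y + brk L x (d y)) \<and>
    (\<forall>x. x \<notin> carr L \<longrightarrow> d x = 0)"
  by (simp add: Der_def linear_map_on_def)

lemma Der_0: "lie_algebra L \<Longrightarrow> d \<in> carr (Der L) \<Longrightarrow> d 0 = 0"
  by (rule linear_map_on_zero [of L L]) (simp_all add: Der_def)

lemma Der_diff:
  "\<lbrakk>lie_algebra L; d \<in> carr (Der L); x \<in> carr L; y \<in> carr L\<rbrakk> \<Longrightarrow> d (x - y) = d x - d y"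
  by (rule linear_map_on_diff [of L L]) (simp_all add: Der_def)

lemma lie_algebra_Der:
  assumes "lie_algebra L"
  shows "lie_algebra (Der L)"
proof -
  interpret lie_algebra L by fact
  have vs: "vector_space (scl (Der L))"
    by unfold_locales (simp_all add: Der_simps fun_eq_iff scale_right_distrib scale_left_distrib)
  interpret D: vector_space "scl (Der L)" by (rule vs)
  note cl = carr_0 carr_add carr_diff carr_scl brk_closed
  show ?thesis
  proof (intro lie_algebra.intro lie_algebra_axioms.intro vs)
    show "D.subspace (carr (Der L))"
    proof (rule D.subspaceI)
      show "0 \<in> carr (Der L)"
        by (simp add: Der_iff cl brk_zero_left brk_zero_right)
      show "d + e \<in> carr (Der L)" if "d \<in> carr (Der L)" "e \<in> carr (Der L)" for d e
        using that by (simp add: Der_iff cl brk_add_left brk_add_right scale_right_distrib)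
      show "scl (Der L) c d \<in> carr (Der L)" if "d \<in> carr (Der L)" for c d
        using that by (simp add: Der_iff Der_simps cl brk_scl_left brk_scl_right
            scale_right_distrib scale_left_commute)
    qed
    fix d e assume d: "d \<in> carr (Der L)" and e: "e \<in> carr (Der L)"
    show "brk (Der L) d e \<in> carr (Der L)"
      unfolding Der_iff
    proof (intro conjI ballI allI impI)
      fix x assume x: "x \<notin> carr L"
      then show "brk (Der L) d e x = 0"
        using d e Der_0 [OF assms d] Der_0 [OF assms e] by (simp add: Der_iff Der_simps)
    qed (use d e in \<open>simp_all add: Der_iff Der_simps cl brk_diff_left brk_diff_right
        scale_right_diff_distrib\<close>)
    \<comment> \<open>The identities are between maps on the whole type. At a point off the carrier
      the inner map gives 0, so there they come down to the values of derivations at 0.\<close>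
    note z0 = Der_0 [OF assms d] Der_0 [OF assms e]
    show "brk (Der L) (scl (Der L) c d) e = scl (Der L) c (brk (Der L) d e)" for c
    proof
      show "brk (Der L) (scl (Der L) c d) e x = scl (Der L) c (brk (Der L) d e) x" for x
        using d e z0
        by (cases "x \<in> carr L") (simp_all add: Der_iff Der_simps scale_right_diff_distrib)
    qed
    show "brk (Der L) d (scl (Der L) c e) = scl (Der L) c (brk (Der L) d e)" for c
    proof
      show "brk (Der L) d (scl (Der L) c e) x = scl (Der L) c (brk (Der L) d e) x" for x
        using d e z0
        by (cases "x \<in> carr L") (simp_all add: Der_iff Der_simps scale_right_diff_distrib)
    qed
    show "brk (Der L) d d = 0"
      by (simp add: Der_simps fun_eq_iff)
    fix f assume f: "f \<in> carr (Der L)"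
    note z = z0 Der_0 [OF assms f]
    show "brk (Der L) (d + e) f = brk (Der L) d f + brk (Der L) e f"
    proof
      show "brk (Der L) (d + e) f x = (brk (Der L) d f + brk (Der L) e f) x" for x
        using d e f z by (cases "x \<in> carr L") (simp_all add: Der_iff Der_simps)
    qed
    show "brk (Der L) d (e + f) = brk (Der L) d e + brk (Der L) d f"
    proof
      show "brk (Der L) d (e + f) x = (brk (Der L) d e + brk (Der L) d f) x" for x
        using d e f z by (cases "x \<in> carr L") (simp_all add: Der_iff Der_simps)
    qed
    show "brk (Der L) d (brk (Der L) e f) + brk (Der L) e (brk (Der L) f d)
      + brk (Der L) f (brk (Der L) d e) = 0"
    proof
      show "(brk (Der L) d (brk (Der L) e f) + brk (Der L) e (brk (Der L) f d)
        + brk (Der L) f (brk (Der L) d e)) x = 0 x" for x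
        using d e f z Der_diff [OF assms d] Der_diff [OF assms e] Der_diff [OF assms f]
        by (cases "x \<in> carr L") (simp_all add: Der_iff Der_simps)
    qed
  qed
qed

lemma ad_Der:
  assumes "lie_algebra L" "x \<in> carr L"
  shows "ad L x \<in> carr (Der L)"
proof -
  interpret lie_algebra L by fact
  show ?thesis
    using assms(2)
    by (simp add: Der_iff ad_def carr_add carr_scl brk_closed brk_add_right brk_scl_right leibniz [of x])
qed

lemma lie_hom_ad:
  assumes "lie_algebra L"
  shows "lie_hom L (Der L) (ad L)"
proof -
  interpret lie_algebra L by fact
  have "ad L (brk L x y) z = brk (Der L) (ad L x) (ad L y) z"
    if "x \<in> carr L" "y \<in> carr L" for x y z
    using that
    by (simp add: ad_def Der_simps brk_closed leibniz [of x y] brk_zero_right)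
  moreover have "ad L (x + y) z = (ad L x + ad L y) z" "ad L (scl L c x) z = scl (Der L) c (ad L x) z"
    if "x \<in> carr L" "y \<in> carr L" for x y z c
    using that by (simp_all add: ad_def Der_simps brk_add_left brk_scl_left)
  ultimately show ?thesis
    unfolding lie_hom_def linear_map_on_def
    by (intro conjI ballI allI ext assms lie_algebra_Der ad_Der)
qed

section \<open>Images, composites and inverses of Lie homomorphisms\<close>

lemma lie_hom_image:
  assumes "lie_hom L M f"
  shows "lie_algebra (M\<lparr>carr := f ` carr L\<rparr>)" "lie_hom L (M\<lparr>carr := f ` carr L\<rparr>) f"
proof -
  interpret L: lie_algebra L using assms by (simp add: lie_hom_def)
  interpret M: lie_algebra M using assms by (simp add: lie_hom_def)
  have f: "f (x + y) = f x + f y" "f (scl L c x) = scl M c (f x)" "f x \<in> carr M"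
    "f (brk L x y) = brk M (f x) (f y)" if "x \<in> carr L" "y \<in> carr L" for x y c
    using assms that by (simp_all add: lie_hom_def linear_map_on_def)
  have "f 0 = 0"
    using assms by (auto simp: lie_hom_def intro: linear_map_on_zero)
  have "M.subspace (f ` carr L)"
  proof (rule M.subspaceI)
    show "0 \<in> f ` carr L"
      using \<open>f 0 = 0\<close> L.carr_0 by (metis imageI)
    show "x + y \<in> f ` carr L" if "x \<in> f ` carr L" "y \<in> f ` carr L" for x y
      using that by (auto simp: f(1) [symmetric] L.carr_add)
    show "scl M c x \<in> f ` carr L" if "x \<in> f ` carr L" for c x
      using that by (auto simp: f(2) [symmetric] L.carr_scl)
  qed
  moreover have "brk M x y \<in> f ` carr L" if "x \<in> f ` carr L" "y \<in> f ` carr L" for x y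
    using that by (auto simp: f(4) [symmetric] L.brk_closed)
  ultimately show "lie_algebra (M\<lparr>carr := f ` carr L\<rparr>)"
    using f(3) M.lie_algebra_axioms by (intro lie_algebra_subalgebra) auto
  then show "lie_hom L (M\<lparr>carr := f ` carr L\<rparr>) f"
    using assms by (simp add: lie_hom_def linear_map_on_def)
qed

lemma lie_isomorphic_image:
  assumes "lie_mono L M f"
  shows "lie_isomorphic L (M\<lparr>carr := f ` carr L\<rparr>)"
  unfolding lie_isomorphic_def
proof (intro exI conjI)
  show "lie_hom L (M\<lparr>carr := f ` carr L\<rparr>) f"
    using assms by (simp add: lie_mono_def lie_hom_image(2))
  show "bij_betw f (carr L) (carr (M\<lparr>carr := f ` carr L\<rparr>))"
    using assms by (simp add: lie_mono_def bij_betw_def)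
qed

lemma lie_hom_comp: "\<lbrakk>lie_hom L M f; lie_hom M N g\<rbrakk> \<Longrightarrow> lie_hom L N (g \<circ> f)"
  by (simp add: lie_hom_def linear_map_on_def)

lemma lie_hom_inv_into:
  assumes f: "lie_hom L M f" and bij: "bij_betw f (carr L) (carr M)"
  shows "lie_hom M L (inv_into (carr L) f)"
proof -
  interpret L: lie_algebra L using f by (simp add: lie_hom_def)
  define g where "g = inv_into (carr L) f"
  have fg: "f (g y) = y" "g y \<in> carr L" if "y \<in> carr M" for y
    using that bij unfolding g_def
    by (auto simp: bij_betw_def f_inv_into_f inv_into_into)
  have gI: "g y = x" if "x \<in> carr L" "f x = y" for x y
    using that bij unfolding g_def by (auto simp: bij_betw_def)
  have "lie_hom M L g"
    unfolding lie_hom_def linear_map_on_def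
  proof (intro conjI ballI allI)
    show "lie_algebra L" "lie_algebra M"
      using f by (simp_all add: lie_hom_def)
  qed (use f in \<open>auto intro!: gI simp: lie_hom_def linear_map_on_def fg
      L.carr_add L.carr_scl L.brk_closed\<close>)
  then show ?thesis
    by (simp add: g_def)
qed

lemma lie_isomorphic_sym: "lie_isomorphic L M \<Longrightarrow> lie_isomorphic M L"
  unfolding lie_isomorphic_def using lie_hom_inv_into bij_betw_inv_into by blast

lemma lie_isomorphic_trans: "\<lbrakk>lie_isomorphic L M; lie_isomorphic M N\<rbrakk> \<Longrightarrow> lie_isomorphic L N"
  unfolding lie_isomorphic_def using lie_hom_comp bij_betw_trans by blast

section \<open>Consequences of a split exact sequence\<close>

text \<open>Applying g to d = j z + f a forces z = g d. Conversely d - j (g d) is killed by g, so it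
  is f a for some a, and a is unique because f is injective.\<close>

lemma split_exact_decomp:
  assumes ex: "short_exact A B C f g" and j: "lie_mono C B j"
    and gj: "\<forall>z\<in>carr C. g (j z) = z" and d: "d \<in> carr B"
  shows "\<exists>!p. fst p \<in> carr C \<and> snd p \<in> carr A \<and> d = j (fst p) + f (snd p)"
proof -
  interpret A: lie_algebra A using ex by (simp add: short_exact_def lie_mono_def lie_hom_def)
  interpret B: lie_algebra B using ex by (simp add: short_exact_def lie_mono_def lie_hom_def)
  interpret C: lie_algebra C using j by (simp add: lie_mono_def lie_hom_def)
  have g: "linear_map_on B C g"
    using ex by (simp add: short_exact_def lie_hom_def)
  have gd: "g d \<in> carr C"
    using g d by (simp add: linear_map_on_def)
  then have jgd: "j (g d) \<in> carr B"
    using j by (simp add: lie_mono_def lie_hom_def linear_map_on_def)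
  have "g (d - j (g d)) = 0"
    using linear_map_on_diff [OF B.lie_algebra_axioms C.lie_algebra_axioms g d jgd] gj gd
    by simp
  then obtain a where a: "a \<in> carr A" "f a = d - j (g d)"
    using ex B.carr_diff [OF d jgd] by (force simp: short_exact_def)
  show ?thesis
  proof (rule ex1I [of _ "(g d, a)"])
    show "fst (g d, a) \<in> carr C \<and> snd (g d, a) \<in> carr A \<and> d = j (fst (g d, a)) + f (snd (g d, a))"
      using a gd by simp
  next
    fix p assume p: "fst p \<in> carr C \<and> snd p \<in> carr A \<and> d = j (fst p) + f (snd p)"
    have fp: "f (snd p) \<in> carr B" "g (f (snd p)) = 0"
      using ex p by (auto simp: short_exact_def)
    moreover have "j (fst p) \<in> carr B"
      using j p by (simp add: lie_mono_def lie_hom_def linear_map_on_def)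
    ultimately have 1: "g d = fst p"
      using g p gj by (simp add: linear_map_on_def)
    then have "f (snd p) = f a"
      using a p by simp
    then have "snd p = a"
      using ex a p by (auto simp: short_exact_def lie_mono_def inj_on_def)
    with 1 show "p = (g d, a)"
      by (auto simp: prod_eq_iff)
  qed
qed

lemma split_exact_direct_sum:
  assumes ex: "short_exact A B C f g" and j: "lie_mono C B j"
    and gj: "\<forall>z\<in>carr C. g (j z) = z"
  shows "direct_sum_of B (f ` carr A) (j ` carr C)"
proof -
  have f: "lie_hom A B f" and j': "lie_hom C B j"
    using ex j by (simp_all add: short_exact_def lie_mono_def)
  interpret B: lie_algebra B using f by (simp add: lie_hom_def)
  interpret C: lie_algebra C using j' by (simp add: lie_hom_def)
  have sub: "B.subspace (f ` carr A)" "B.subspace (j ` carr C)"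
    using lie_algebra.subspace_carr [OF lie_hom_image(1) [OF f]]
      lie_algebra.subspace_carr [OF lie_hom_image(1) [OF j']] by simp_all
  have "x = 0" if x: "x \<in> f ` carr A" "x \<in> j ` carr C" for x
  proof -
    obtain z where z: "z \<in> carr C" "x = j z"
      using x by blast
    then have "z = 0"
      using ex x gj by (auto simp: short_exact_def)
    with z j' show ?thesis
      by (auto simp: lie_hom_def intro: linear_map_on_zero)
  qed
  then have "f ` carr A \<inter> j ` carr C = {0}"
    using B.subspace_0 sub by blast
  moreover have "carr B = {u + w | u w. u \<in> f ` carr A \<and> w \<in> j ` carr C}"
  proof (intro set_eqI iffI)
    fix d assume "d \<in> carr B"
    from split_exact_decomp [OF ex j gj this]
    obtain p where "fst p \<in> carr C" "snd p \<in> carr A" "d = j (fst p) + f (snd p)"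
      by blast
    then have "d = f (snd p) + j (fst p)"
      by (simp add: add.commute)
    then show "d \<in> {u + w | u w. u \<in> f ` carr A \<and> w \<in> j ` carr C}"
      using \<open>fst p \<in> carr C\<close> \<open>snd p \<in> carr A\<close> by blast
  next
    fix d assume "d \<in> {u + w | u w. u \<in> f ` carr A \<and> w \<in> j ` carr C}"
    then show "d \<in> carr B"
      using f j' by (auto simp: lie_hom_def linear_map_on_def intro!: B.carr_add)
  qed
  ultimately show ?thesis
    using sub by (simp add: direct_sum_of_def)
qed

section \<open>Ideals under homomorphisms, and an obstruction to solvability\<close>

lemma lie_ideal_vimage:
  assumes f: "lie_hom L M f" and I: "lie_ideal M I"
  shows "lie_ideal L {x \<in> carr L. f x \<in> I}"
proof -
  interpret L: lie_algebra L using f by (simp add: lie_hom_def)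
  interpret M: lie_algebra M using f by (simp add: lie_hom_def)
  have I': "M.subspace I" "\<And>x y. x \<in> carr M \<Longrightarrow> y \<in> I \<Longrightarrow> brk M x y \<in> I"
    using I by (auto simp: lie_ideal_def)
  have f': "f x \<in> carr M" "f (x + y) = f x + f y" "f (scl L c x) = scl M c (f x)"
    "f (brk L x y) = brk M (f x) (f y)" if "x \<in> carr L" "y \<in> carr L" for x y c
    using f that by (simp_all add: lie_hom_def linear_map_on_def)
  have "f 0 = 0"
    using f by (auto simp: lie_hom_def intro: linear_map_on_zero)
  then have "L.subspace {x \<in> carr L. f x \<in> I}"
    using I' by (intro L.subspaceI) (auto simp: f' L.carr_0 L.carr_add L.carr_scl
      M.subspace_0 M.subspace_add M.subspace_scale)
  then show ?thesis
    using I' by (auto simp: lie_ideal_def f' L.brk_closed)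
qed

lemma lie_ideal_image:
  assumes f: "lie_hom L M f" and surj: "f ` carr L = carr M" and I: "lie_ideal L I"
  shows "lie_ideal M (f ` I)"
proof -
  interpret L: lie_algebra L using f by (simp add: lie_hom_def)
  interpret M: lie_algebra M using f by (simp add: lie_hom_def)
  have I': "I \<subseteq> carr L" "L.subspace I" "\<And>x y. x \<in> carr L \<Longrightarrow> y \<in> I \<Longrightarrow> brk L x y \<in> I"
    using I by (auto simp: lie_ideal_def)
  have f': "f x + f y = f (x + y)" "brk M (f x) (f y) = f (brk L x y)"
    if "x \<in> carr L" "y \<in> carr L" for x y
    using f that by (simp_all add: lie_hom_def linear_map_on_def)
  have f'': "f x \<in> carr M" "scl M c (f x) = f (scl L c x)" if "x \<in> carr L" for x c
    using f that by (simp_all add: lie_hom_def linear_map_on_def)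
  have f0: "f 0 = 0"
    using f by (auto simp: lie_hom_def intro: linear_map_on_zero)
  have sub: "x \<in> carr L" if "x \<in> I" for x
    using that I'(1) by blast
  have "M.subspace (f ` I)"
  proof (rule M.subspaceI)
    show "0 \<in> f ` I"
      using f0 L.subspace_0 [OF I'(2)] by (metis imageI)
  qed (auto simp: f' f'' sub L.subspace_add [OF I'(2)] L.subspace_scale [OF I'(2)])
  moreover have "brk M x y \<in> f ` I" if x: "x \<in> carr M" and y: "y \<in> f ` I" for x y
  proof -
    obtain x' y' where "x' \<in> carr L" "x = f x'" "y' \<in> I" "y = f y'"
      using x y surj by blast
    then show ?thesis
      by (simp add: f' sub I'(3))
  qed
  ultimately show ?thesis
    by (auto simp: lie_ideal_def f'' sub)
qed

lemma derived_series_subset: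
  assumes "lie_algebra L" "S \<subseteq> carr L"
  shows "derived_series L S n \<subseteq> carr L"
proof (induction n)
  case 0
  then show ?case using assms by simp
next
  case (Suc n)
  interpret lie_algebra L by fact
  have "{brk L x y |x y. x \<in> derived_series L S n \<and> y \<in> derived_series L S n} \<subseteq> carr L"
    using Suc brk_closed by blast
  then show ?case
    using span_minimal [OF _ subspace_carr] by simp
qed

text \<open>This is the obstruction to solvability: if every element of S is a single bracket of
  elements of S, lifting the two factors to a term of the derived series lifts the element to the
  next term. S may be any set, for instance a handful of basis vectors, which avoids spans in the
  target.\<close>

lemma perfect_subset_derived_series:
  assumes g: "lie_hom B C g" and "I \<subseteq> carr B" "S \<subseteq> g ` I"
    and perfect: "S \<subseteq> {brk C x y | x y. x \<in> S \<and> y \<in> S}"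
  shows "S \<subseteq> g ` derived_series B I n"
proof (induction n)
  case 0
  then show ?case using assms by simp
next
  case (Suc n)
  interpret B: lie_algebra B using g by (simp add: lie_hom_def)
  show ?case
  proof
    fix s assume "s \<in> S"
    then obtain x y where xy: "x \<in> S" "y \<in> S" "s = brk C x y"
      using perfect by blast
    then obtain x' y' where x'y': "x' \<in> derived_series B I n" "y' \<in> derived_series B I n"
      "x = g x'" "y = g y'"
      using Suc by blast
    then have "x' \<in> carr B" "y' \<in> carr B"
      using derived_series_subset [OF B.lie_algebra_axioms \<open>I \<subseteq> carr B\<close>] by blast+
    then have "s = g (brk B x' y')"
      using g xy x'y' by (simp add: lie_hom_def)
    moreover have "brk B x' y' \<in> derived_series B I (Suc n)"
      using x'y' by (auto intro!: B.span_base)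
    ultimately show "s \<in> g ` derived_series B I (Suc n)"
      by blast
  qed
qed

section \<open>The matrix algebras\<close>

lemma matrix_diff_ldistrib:
  fixes A :: "'a::ring_1^'n^'m"
  shows "A ** (B - C) = A ** B - A ** C"
  by (simp add: matrix_matrix_mult_def vec_eq_iff right_diff_distrib sum_subtractf)

lemma matrix_diff_rdistrib:
  fixes A B :: "'a::ring_1^'n^'m"
  shows "(A - B) ** C = A ** C - B ** C"
  by (simp add: matrix_matrix_mult_def vec_eq_iff left_diff_distrib sum_subtractf)

lemma lie_algebra_matrix_lie:
  fixes S :: "('a::field^'n^'n) set"
  assumes "0 \<in> S" "\<And>A B. \<lbrakk>A \<in> S; B \<in> S\<rbrakk> \<Longrightarrow> A + B \<in> S"
    and "\<And>c A. A \<in> S \<Longrightarrow> (\<chi> i. c *s (A $ i)) \<in> S"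
    and "\<And>A B. \<lbrakk>A \<in> S; B \<in> S\<rbrakk> \<Longrightarrow> A ** B - B ** A \<in> S"
  shows "lie_algebra (matrix_lie S)"
proof -
  have vs: "vector_space (scl (matrix_lie S))"
    by unfold_locales (simp_all add: matrix_lie_def vec_eq_iff algebra_simps)
  interpret vector_space "scl (matrix_lie S)" by (rule vs)
  show ?thesis
  proof (intro lie_algebra.intro lie_algebra_axioms.intro vs)
    show "subspace (carr (matrix_lie S))"
      using assms by (intro subspaceI) (simp_all add: matrix_lie_def)
  next
    fix A B C :: "'a^'n^'n"
    show "brk (matrix_lie S) A (brk (matrix_lie S) B C) + brk (matrix_lie S) B (brk (matrix_lie S) C A)
        + brk (matrix_lie S) C (brk (matrix_lie S) A B) = 0"
      by (simp add: matrix_lie_def matrix_diff_ldistrib matrix_diff_rdistrib matrix_mul_assoc)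
  qed (use assms in \<open>simp_all add: matrix_lie_def vec_eq_iff matrix_matrix_mult_def algebra_simps
      sum.distrib sum_distrib_left\<close>)
qed

lemma o4_simps:
  "carr o4 = {M :: 'a::field^4^4. transpose M = - M}"
  "scl o4 = (\<lambda>c (A :: 'a::field^4^4). \<chi> i. c *s (A $ i))"
  "brk o4 = (\<lambda>(A :: 'a::field^4^4) B. A ** B - B ** A)"
  by (simp_all add: o4_def matrix_lie_def)

lemma o4_iff: "(M :: 'a::field^4^4) \<in> carr o4 \<longleftrightarrow> (\<forall>i j. M $ i $ j = - (M $ j $ i))"
proof -
  have "M \<in> carr o4 \<longleftrightarrow> (\<forall>i j. M $ j $ i = - (M $ i $ j))"
    by (simp only: o4_simps transpose_def vec_eq_iff mem_Collect_eq vec_lambda_beta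
        vector_uminus_component)
  then show ?thesis
    by blast
qed

lemma lie_algebra_o4: "lie_algebra (o4 :: ('a::field, 'a^4^4) lie_alg)"
  unfolding o4_def
proof (rule lie_algebra_matrix_lie)
  fix A B :: "'a^4^4"
  assume "A \<in> {M. transpose M = - M}" "B \<in> {M. transpose M = - M}"
  then have *: "transpose A = - A" "transpose B = - B" by simp_all
  have "transpose (A ** B - B ** A) = transpose B ** transpose A - transpose A ** transpose B"
    by (simp add: vec_eq_iff transpose_def matrix_matrix_mult_def mult.commute)
  also have "\<dots> = - (A ** B - B ** A)"
    by (simp add: * vec_eq_iff matrix_matrix_mult_def)
  finally show "A ** B - B ** A \<in> {M. transpose M = - M}"
    by simp
  have "transpose (A + B) = transpose A + transpose B"
    by (simp add: transpose_def vec_eq_iff)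
  with * show "A + B \<in> {M. transpose M = - M}"
    by simp
next
  fix c and A :: "'a^4^4"
  assume "A \<in> {M. transpose M = - M}"
  then have *: "transpose A = - A" by simp
  have "transpose (\<chi> i. c *s (A $ i)) = (\<chi> i. c *s (transpose A $ i))"
    by (simp add: transpose_def vec_eq_iff)
  then show "(\<chi> i. c *s (A $ i)) \<in> {M. transpose M = - M}"
    by (simp add: * vec_eq_iff)
qed (simp add: transpose_def vec_eq_iff)

lemma lie_algebra_sl2: "lie_algebra (sl2 :: ('a::field, 'a^2^2) lie_alg)"
  unfolding sl2_def
proof (rule lie_algebra_matrix_lie)
  show "(\<chi> i. c *s (A $ i)) \<in> {M. trace M = 0}" if "A \<in> {M. trace M = 0}"
    for c and A :: "'a^2^2"
    using that by (simp add: trace_def flip: sum_distrib_left)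
next
  show "A ** B - B ** A \<in> {M. trace M = 0}" for A B :: "'a^2^2"
    using trace_mul_sym [of A B] by (simp add: trace_sub)
qed (simp_all add: trace_def sum.distrib)

lemma lie_algebra_lie_prod:
  assumes "lie_algebra L" "lie_algebra M"
  shows "lie_algebra (lie_prod L M)"
proof -
  interpret L: lie_algebra L by fact
  interpret M: lie_algebra M by fact
  have vs: "vector_space (scl (lie_prod L M))"
    by unfold_locales (auto simp: lie_prod_def L.scale_right_distrib M.scale_right_distrib
      L.scale_left_distrib M.scale_left_distrib)
  interpret vector_space "scl (lie_prod L M)" by (rule vs)
  show ?thesis
  proof (intro lie_algebra.intro lie_algebra_axioms.intro vs)
    show "subspace (carr (lie_prod L M))"
      by (intro subspaceI) (auto simp: lie_prod_def zero_prod_def L.carr_0 M.carr_0 L.carr_add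
        M.carr_add L.carr_scl M.carr_scl)
  qed (auto simp: lie_prod_def zero_prod_def L.brk_closed M.brk_closed L.brk_add_left M.brk_add_left
     L.brk_add_right M.brk_add_right L.brk_scl_left M.brk_scl_left L.brk_scl_right M.brk_scl_right
     L.brk_self M.brk_self L.jacobi M.jacobi)
qed

lemma lie_algebra_scal_vec: "lie_algebra (scal_vec :: ('a::field, 'a \<times> ('a^4)) lie_alg)"
proof -
  have vs: "vector_space (scl (scal_vec :: ('a::field, 'a \<times> ('a^4)) lie_alg))"
    by unfold_locales (auto simp: scal_vec_def vec_eq_iff algebra_simps)
  interpret vector_space "scl (scal_vec :: ('a::field, 'a \<times> ('a^4)) lie_alg)" by (rule vs)
  show ?thesis
  proof (intro lie_algebra.intro lie_algebra_axioms.intro vs)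
    show "subspace (carr (scal_vec :: ('a::field, 'a \<times> ('a^4)) lie_alg))"
      using subspace_UNIV by (simp add: scal_vec_def)
  qed (auto simp: scal_vec_def vec_eq_iff algebra_simps zero_prod_def)
qed

section \<open>Calculus of block matrices\<close>

lemma block_eq_iff [simp]: "block v M = block v' M' \<longleftrightarrow> v = v' \<and> M = M'"
  by (metis row_part_block mat_part_block)

lemma block_add: "block v M + block v' M' = block (v + v') (M + M')"
  by (simp add: block_def vec_eq_iff split: sum.split)

lemma block_diff: "block v M - block v' M' = block (v - v') (M - M')"
  by (simp add: block_def vec_eq_iff split: sum.split)

lemma block_0: "block 0 0 = 0"
  by (simp add: block_def vec_eq_iff split: sum.split)

lemma block_scl: "scl poincare c (block v M) = block (c *s v) (scl o4 c M)"
  by (simp add: block_def poincare_def matrix_lie_def o4_simps vec_eq_iff split: sum.split)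

lemma carr_poincare: "carr poincare = {block v M | v M. M \<in> carr o4}"
  by (simp add: poincare_def matrix_lie_def)

lemma block_in_poincare [simp]: "block v M \<in> carr poincare \<longleftrightarrow> M \<in> carr o4"
  by (auto simp: carr_poincare)

lemma poincareE:
  assumes "X \<in> carr poincare"
  obtains v M where "X = block v M" "M \<in> carr o4"
  using assms by (auto simp: carr_poincare)

lemma lie_algebra_poincare: "lie_algebra (poincare :: ('a::field, 'a mat5) lie_alg)"
proof -
  interpret o4: lie_algebra "o4 :: ('a::field, 'a^4^4) lie_alg" by (rule lie_algebra_o4)
  show ?thesis
    unfolding poincare_def
  proof (rule lie_algebra_matrix_lie; unfold mem_Collect_eq)
    show "\<exists>v M. 0 = block v (M :: 'a^4^4) \<and> M \<in> carr o4"
      using o4.carr_0 block_0 by metis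
  next
    fix A B :: "'a mat5"
    assume "\<exists>v M. A = block v M \<and> M \<in> carr o4" "\<exists>v M. B = block v M \<and> M \<in> carr o4"
    then obtain v M v' M' where *: "A = block v M" "M \<in> carr o4" "B = block v' M'" "M' \<in> carr o4"
      by auto
    then show "\<exists>v M. A + B = block v M \<and> M \<in> carr o4"
      by (auto simp: block_add o4.carr_add)
    have "A ** B - B ** A = block (v v* M' - v' v* M) (brk o4 M M')"
      using brk_poincare_block [of v M v' M'] by (simp add: * poincare_def matrix_lie_def)
    then show "\<exists>v M. A ** B - B ** A = block v M \<and> M \<in> carr o4"
      using * o4.brk_closed by blast
  next
    fix c and A :: "'a mat5"
    assume "\<exists>v M. A = block v M \<and> M \<in> carr o4"
    then obtain v M where *: "A = block v M" "M \<in> carr o4"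
      by auto
    have "(\<chi> i. c *s (A $ i)) = block (c *s v) (scl o4 c M)"
      using block_scl [of c v M] by (simp add: * poincare_def matrix_lie_def)
    then show "\<exists>v M. (\<chi> i. c *s (A $ i)) = block v M \<and> M \<in> carr o4"
      using * o4.carr_scl by blast
  qed
qed

lemma poincare_parts:
  "X \<in> carr poincare \<Longrightarrow> mat_part X \<in> carr o4"
  "X \<in> carr poincare \<Longrightarrow> block (row_part X) (mat_part X) = X"
  by (auto simp: carr_poincare)

lemma mat_part_simps:
  "mat_part 0 = 0" "mat_part (X + Y) = mat_part X + mat_part Y"
  "mat_part (X - Y) = mat_part X - mat_part Y"
  "mat_part (scl poincare c X) = scl o4 c (mat_part X)"
  by (simp_all add: mat_part_def o4_simps poincare_def matrix_lie_def vec_eq_iff)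

lemma row_part_simps:
  "row_part 0 = 0" "row_part (X + Y) = row_part X + row_part Y"
  "row_part (X - Y) = row_part X - row_part Y"
  "row_part (scl poincare c X) = c *s row_part X"
  by (simp_all add: row_part_def poincare_def matrix_lie_def vec_eq_iff)

lemma brk_poincare_parts:
  assumes "X \<in> carr poincare" "Y \<in> carr poincare"
  shows "mat_part (brk poincare X Y) = brk o4 (mat_part X) (mat_part Y)"
    and "row_part (brk poincare X Y) = row_part X v* mat_part Y - row_part Y v* mat_part X"
  using assms by (auto simp: carr_poincare brk_poincare_block)

section \<open>Elementary skew-symmetric matrices and the structure of \<open>o4\<close>\<close>

text \<open>This is E_ij - E_ji for the matrix units E_ij. In characteristic 2 these matrices have
  zero diagonal while \<open>o4\<close> consists of all symmetric matrices, so there they span only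
  a proper subspace of \<open>o4\<close>.\<close>

definition skew_unit :: "'n \<Rightarrow> 'n \<Rightarrow> 'a::ring_1^'n^'n"
  where "skew_unit i j = (\<chi> a b. (if a = i \<and> b = j then 1 else 0) - (if a = j \<and> b = i then 1 else 0))"

lemma skew_unit_component:
  "skew_unit i j $ a $ b = (if a = i \<and> b = j then 1 else 0) - (if a = j \<and> b = i then 1 else 0)"
  by (simp add: skew_unit_def)

lemma skew_unit_o4 [simp]: "skew_unit i j \<in> carr o4"
  by (simp only: o4_iff skew_unit_def vec_lambda_beta minus_diff_eq conj_commute simp_thms)

lemma skew_unit_swap: "skew_unit j i = - skew_unit i j"
  by (simp only: skew_unit_def vec_eq_iff vec_lambda_beta vector_uminus_component minus_diff_eq
      simp_thms)

lemma vec_mult_skew_unit: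
  "(v v* skew_unit i j) $ b = (if b = j then v $ i else 0) - (if b = i then v $ j else 0)"
  for v :: "'a::field^'n"
  by (cases "b = i"; cases "b = j") (simp_all add: vector_matrix_mult_def skew_unit_def
      left_diff_distrib right_diff_distrib sum_subtractf mult_delta_left mult_delta_right)

lemma skew_unit_mult:
  "(skew_unit i j ** M) $ a $ b = (if a = i then M $ j $ b else 0) - (if a = j then M $ i $ b else 0)"
  for M :: "'a::field^'n^'n"
  by (cases "a = i"; cases "a = j") (simp_all add: matrix_matrix_mult_def skew_unit_def
      left_diff_distrib right_diff_distrib sum_subtractf mult_delta_left mult_delta_right)

lemma mult_skew_unit:
  "(M ** skew_unit i j) $ a $ b = (if b = j then M $ a $ i else 0) - (if b = i then M $ a $ j else 0)"
  for M :: "'a::field^'n^'n"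
  by (cases "b = i"; cases "b = j") (simp_all add: matrix_matrix_mult_def skew_unit_def
      left_diff_distrib right_diff_distrib sum_subtractf mult_delta_left mult_delta_right)

lemma brk_skew_unit_component:
  "brk o4 (skew_unit i j) M $ a $ b =
    (if a = i then M $ j $ b else 0) - (if a = j then M $ i $ b else 0)
    - ((if b = j then M $ a $ i else 0) - (if b = i then M $ a $ j else 0))"
  by (simp add: o4_simps skew_unit_mult mult_skew_unit)

text \<open>The computations with \<open>skew_unit\<close> test an identity at an entry chosen away
  from the indices already in use; dimension 4 leaves room for one more index.\<close>

lemma fourth_index: "\<exists>i::4. i \<noteq> j \<and> i \<noteq> k \<and> i \<noteq> l"
proof -
  have "card {j, k, l} < CARD(4)"
    using card_insert_le_m1[of 3 "{k, l}" j] card_insert_le_m1[of 2 "{l}" k] by simp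
  then have "{j, k, l} \<noteq> UNIV"
    by (metis less_irrefl)
  then show ?thesis
    by blast
qed

lemma o4_diag:
  fixes M :: "'a::field^4^4"
  assumes "(2::'a) \<noteq> 0" "M \<in> carr o4"
  shows "M $ i $ i = 0"
proof -
  have "M $ i $ i + M $ i $ i = 0"
    using assms(2) by (metis o4_iff add.right_inverse)
  then have "2 * M $ i $ i = 0"
    by (simp only: mult_2)
  with assms(1) show ?thesis by simp
qed

text \<open>For i different from j, k and b, the entry (i, b) of the commutator of
  \<open>skew_unit i j\<close> with M is just the entry (j, b) of M. This clears all off-diagonal
  entries outside row k; the zero diagonal and skewness do the rest.\<close>

lemma o4_centralizer_eq_0:
  fixes M :: "'a::field^4^4"
  assumes two: "(2::'a) \<noteq> 0" and M: "M \<in> carr o4"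
    and comm: "\<And>i j. \<lbrakk>i \<noteq> k; j \<noteq> k\<rbrakk> \<Longrightarrow> brk o4 (skew_unit i j) M = 0"
  shows "M = 0"
proof -
  have *: "M $ j $ b = 0" if "j \<noteq> k" for j b
  proof (cases "j = b")
    case True
    then show ?thesis using o4_diag [OF two M] by simp
  next
    case False
    obtain i where "i \<noteq> j" "i \<noteq> k" "i \<noteq> b"
      using fourth_index by blast
    then have "brk o4 (skew_unit i j) M $ i $ b = M $ j $ b"
      using False by (simp add: brk_skew_unit_component)
    then show ?thesis
      using comm \<open>i \<noteq> k\<close> that by simp
  qed
  have "M $ a $ b = 0" for a b
  proof (cases "a = k")
    case True
    then show ?thesis
      using * [of b a] o4_diag [OF two M, of a] M
        o4_iff [of M, THEN iffD1, rule_format, of a b]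
      by (cases "b = k") simp_all
  next
    case False
    then show ?thesis by (rule *)
  qed
  then show ?thesis
    by (simp add: vec_eq_iff)
qed

lemma mat_in_o4:
  assumes "(2::'a::field) = 0"
  shows "(mat c :: 'a^4^4) \<in> carr o4"
proof -
  have "c = - c"
    using mult_2 [of c] assms by (simp add: eq_neg_iff_add_eq_0)
  then show ?thesis
    by (simp add: o4_iff mat_def)
qed

lemma brk_o4_mat: "brk o4 (mat c) M = 0" "brk o4 M (mat c) = 0"
  by (simp_all add: o4_simps vec_eq_iff matrix_matrix_mult_def mat_def mult_delta_left
      mult_delta_right mult.commute)

lemma o4_induct [consumes 2, case_names add scl unit]:
  fixes M :: "'a::field^4^4"
  assumes two: "(2::'a) \<noteq> 0" and M: "M \<in> carr o4"
    and add: "\<And>A B. \<lbrakk>A \<in> carr o4; B \<in> carr o4; P A; P B\<rbrakk> \<Longrightarrow> P (A + B)"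
    and scl: "\<And>c A. \<lbrakk>A \<in> carr o4; P A\<rbrakk> \<Longrightarrow> P (scl o4 c A)"
    and unit: "\<And>i j. i \<noteq> j \<Longrightarrow> P (skew_unit i j)"
  shows "P M"
proof -
  interpret o4: lie_algebra "o4 :: ('a, 'a^4^4) lie_alg" by (rule lie_algebra_o4)
  define T where "T i j = scl o4 (M $ i $ j) (skew_unit i j)" for i j
  have *: "P (T i j)" "T i j \<in> carr o4" if "i \<noteq> j" for i j
    using that by (simp_all add: T_def scl unit o4.carr_scl)
  have sk: "M $ 2 $ 1 = - (M $ 1 $ 2)" "M $ 3 $ 1 = - (M $ 1 $ 3)" "M $ 4 $ 1 = - (M $ 1 $ 4)"
     "M $ 3 $ 2 = - (M $ 2 $ 3)" "M $ 4 $ 2 = - (M $ 2 $ 4)" "M $ 4 $ 3 = - (M $ 3 $ 4)"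
    using M o4_iff by blast+
  \<comment> \<open>The diagonal of M vanishes because 2 is nonzero, so the six units above the
    diagonal suffice.\<close>
  have "M = T 1 2 + T 1 3 + T 1 4 + T 2 3 + T 2 4 + T 3 4"
    by (simp add: T_def o4_simps vec_eq_iff forall_4 skew_unit_def sk o4_diag [OF two M])
  moreover have "P (T 1 2 + T 1 3 + T 1 4 + T 2 3 + T 2 4 + T 3 4)"
    by (intro add * o4.carr_add) simp_all
  ultimately show ?thesis
    by simp
qed

section \<open>Derivations of the Poincare algebra\<close>

lemma Der_poincare_translation_mat_part_odd:
  fixes d :: "'a::field mat5 \<Rightarrow> 'a mat5"
  assumes two: "(2::'a) \<noteq> 0" and d: "d \<in> carr (Der poincare)"
  shows "mat_part (d (block v 0)) = 0"
proof -
  interpret o4: lie_algebra "o4 :: ('a, 'a^4^4) lie_alg" by (rule lie_algebra_o4)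
  define f where "f v = mat_part (d (block v 0))" for v
  have V: "block w 0 \<in> carr (poincare :: ('a, 'a mat5) lie_alg)" for w
    by (simp add: o4.carr_0)
  have dV: "d (block w 0) \<in> carr poincare" for w
    using d V by (simp add: Der_iff)
  have f0: "f 0 = 0"
    using Der_0 [OF lie_algebra_poincare d] by (simp add: f_def block_0 mat_part_simps)
  \<comment> \<open>Leibniz rule for [x, w] = - w x, where w is a translation. The term [d x, w] is
    again a translation and contributes nothing to the matrix part.\<close>
  have equivariant: "f (- (w v* x)) = brk o4 x (f w)" if x: "x \<in> carr o4" for w x
  proof -
    have X: "block 0 x \<in> carr (poincare :: ('a, 'a mat5) lie_alg)"
      using x by simp
    have dX: "d (block 0 x) \<in> carr poincare"
      using d X by (simp add: Der_iff)
    have "brk poincare (block 0 x) (block w 0) = block (- (w v* x)) 0"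
      using x by (simp add: brk_poincare_block o4.brk_zero_right)
    then have "d (block (- (w v* x)) 0)
        = brk poincare (d (block 0 x)) (block w 0) + brk poincare (block 0 x) (d (block w 0))"
      using d X V [of w] unfolding Der_iff by metis
    then show ?thesis
      using X V dX dV x poincare_parts(1) [OF dX]
      by (simp add: f_def mat_part_simps brk_poincare_parts o4.brk_zero_right)
  qed
  have f_o4: "f w \<in> carr o4" for w
    using dV poincare_parts(1) by (auto simp: f_def)
  have f_axis: "f (axis k 1) = 0" for k
  proof (rule o4_centralizer_eq_0 [OF two f_o4])
    fix i j assume "i \<noteq> k" "j \<noteq> k"
    then have "axis k 1 v* skew_unit i j = (0 :: 'a^4)"
      by (simp add: vec_eq_iff vec_mult_skew_unit axis_def)
    then show "brk o4 (skew_unit i j) (f (axis k 1)) = 0"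
      using equivariant [of "skew_unit i j" "axis k 1"] f0 by simp
  qed
  have f_add: "f (u + w) = f u + f w" for u w
  proof -
    have "block (u + w) 0 = block u 0 + block w (0 :: 'a^4^4)"
      by (simp add: block_add)
    then show ?thesis
      using d V by (simp add: f_def Der_iff mat_part_simps)
  qed
  have f_scl: "f (c *s w) = scl o4 c (f w)" for c w
  proof -
    have "block (c *s w) 0 = scl poincare c (block w (0 :: 'a^4^4))"
      by (simp add: block_scl)
    then show ?thesis
      using d V by (simp add: f_def Der_iff mat_part_simps)
  qed
  have "f v = f (\<Sum>k\<in>UNIV. v $ k *s axis k 1)"
    by (simp add: basis_expansion)
  also have "\<dots> = 0"
    by (simp add: sum_4 f_add f_scl f_axis)
  finally show ?thesis
    by (simp add: f_def)
qed

text \<open>In characteristic 2 the identity matrix I lies in \<open>o4\<close> and [I, v] = - v. In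
  the Leibniz rule for this bracket both terms have zero matrix part: [d I, v] is a translation, and
  [I, d v] is a bracket with a matrix that is central in \<open>o4\<close>.\<close>

lemma Der_poincare_translation_mat_part:
  fixes d :: "'a::field mat5 \<Rightarrow> 'a mat5"
  assumes d: "d \<in> carr (Der poincare)"
  shows "mat_part (d (block v 0)) = 0"
proof (cases "(2::'a) = 0")
  case True
  interpret o4: lie_algebra "o4 :: ('a, 'a^4^4) lie_alg" by (rule lie_algebra_o4)
  have I: "block 0 (mat 1) \<in> carr (poincare :: ('a, 'a mat5) lie_alg)"
    using mat_in_o4 [OF True] by simp
  have V: "block v 0 \<in> carr (poincare :: ('a, 'a mat5) lie_alg)"
    by (simp add: o4.carr_0)
  have dI: "d (block 0 (mat 1)) \<in> carr poincare" and dV: "d (block v 0) \<in> carr poincare"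
    using d I V by (simp_all add: Der_iff)
  have "block (- v) 0 = (0 :: 'a mat5) - block v 0"
    by (simp add: block_diff flip: block_0)
  then have "d (block (- v) 0) = - d (block v 0)"
    using Der_diff [OF lie_algebra_poincare d _ V, of 0] Der_0 [OF lie_algebra_poincare d]
      lie_algebra.carr_0 [OF lie_algebra_poincare] by simp
  moreover have "brk poincare (block 0 (mat 1)) (block v 0) = block (- v) 0"
    by (simp add: brk_poincare_block brk_o4_mat)
  ultimately have "- d (block v 0) = brk poincare (d (block 0 (mat 1))) (block v 0)
      + brk poincare (block 0 (mat 1)) (d (block v 0))"
    using d I V unfolding Der_iff by metis
  then have "mat_part (- d (block v 0)) = 0"
    using I V dI dV poincare_parts(1) [OF dI]
    by (simp add: mat_part_simps brk_poincare_parts brk_o4_mat o4.brk_zero_right)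
  then show ?thesis
    using mat_part_simps(3) [of 0 "d (block v 0)"] by (simp add: mat_part_simps(1))
next
  case False
  then show ?thesis
    using d by (rule Der_poincare_translation_mat_part_odd)
qed

lemma Der_poincare_block:
  fixes d :: "'a::field mat5 \<Rightarrow> 'a mat5"
  assumes d: "d \<in> carr (Der poincare)" and M: "M \<in> carr o4"
  shows "d (block v M) = d (block v 0) + d (block 0 M)"
proof -
  interpret o4: lie_algebra "o4 :: ('a, 'a^4^4) lie_alg" by (rule lie_algebra_o4)
  have "d (block v 0 + block 0 M) = d (block v 0) + d (block 0 M)"
    using d M o4.carr_0 by (simp add: Der_iff)
  then show ?thesis
    by (simp add: block_add)
qed

text \<open>Since d preserves the translations, it induces a map on the quotient of p by them, and
  \<open>qmap d\<close> is that map. This is what makes \<open>qmap\<close> compatible with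
  composition, hence with brackets.\<close>

lemma qmap_mat_part:
  fixes d :: "'a::field mat5 \<Rightarrow> 'a mat5"
  assumes "d \<in> carr (Der poincare)" "X \<in> carr poincare"
  shows "mat_part (d X) = qmap d (mat_part X)"
proof -
  obtain v M where "X = block v M" "M \<in> carr o4"
    using assms(2) by (rule poincareE)
  then show ?thesis
    using assms Der_poincare_translation_mat_part [OF assms(1)]
    by (simp add: qmap_def Der_poincare_block [of d M v] mat_part_simps)
qed

lemma qmap_Der:
  fixes d :: "'a::field mat5 \<Rightarrow> 'a mat5"
  assumes d: "d \<in> carr (Der poincare)"
  shows "qmap d \<in> carr (Der o4)"
  unfolding Der_iff
proof (intro conjI ballI allI impI)
  fix x y :: "'a^4^4" assume x: "x \<in> carr o4" and y: "y \<in> carr o4"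
  then have X: "block 0 x \<in> carr (poincare :: ('a, 'a mat5) lie_alg)"
    "block 0 y \<in> carr (poincare :: ('a, 'a mat5) lie_alg)"
    by simp_all
  then have dX: "d (block 0 x) \<in> carr poincare" "d (block 0 y) \<in> carr poincare"
    using d by (simp_all add: Der_iff)
  then show "qmap d x \<in> carr o4"
    by (simp add: qmap_def poincare_parts)
  have "block 0 (x + y) = block 0 x + block (0 :: 'a^4) y"
    by (simp add: block_add)
  then show "qmap d (x + y) = qmap d x + qmap d y"
    using d X by (simp add: qmap_def Der_iff mat_part_simps)
  have "block 0 (brk o4 x y) = brk poincare (block 0 x) (block (0 :: 'a^4) y)"
    by (simp add: brk_poincare_block)
  then show "qmap d (brk o4 x y) = brk o4 (qmap d x) y + brk o4 x (qmap d y)"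
    using d X dX by (simp add: qmap_def Der_iff mat_part_simps brk_poincare_parts)
next
  fix c and x :: "'a^4^4" assume x: "x \<in> carr o4"
  have "block 0 (scl o4 c x) = scl poincare c (block (0 :: 'a^4) x)"
    by (simp add: block_scl)
  then show "qmap d (scl o4 c x) = scl o4 c (qmap d x)"
    using d x by (simp add: qmap_def Der_iff mat_part_simps)
next
  fix x :: "'a^4^4" assume "x \<notin> carr o4"
  then show "qmap d x = 0"
    using d by (simp add: qmap_def Der_iff mat_part_simps)
qed

lemma lie_hom_qmap:
  "lie_hom (Der poincare) (Der o4) (qmap :: ('a::field mat5 \<Rightarrow> 'a mat5) \<Rightarrow> _)"
proof -
  have "qmap (brk (Der poincare) d e) = brk (Der o4) (qmap d) (qmap e)"
    if d: "d \<in> carr (Der poincare)" and e: "e \<in> carr (Der poincare)" for d e :: "'a mat5 \<Rightarrow> 'a mat5"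
  proof
    fix x :: "'a^4^4"
    show "qmap (brk (Der poincare) d e) x = brk (Der o4) (qmap d) (qmap e) x"
    proof (cases "x \<in> carr o4")
      case True
      then have "d (block 0 x) \<in> carr poincare" "e (block 0 x) \<in> carr poincare"
        using d e by (simp_all add: Der_iff)
      then have "mat_part (d (e (block 0 x))) = qmap d (qmap e x)"
        "mat_part (e (d (block 0 x))) = qmap e (qmap d x)"
        using d e by (simp_all add: qmap_mat_part True)
      then show ?thesis
        by (simp add: qmap_def Der_simps mat_part_simps)
    next
      case False
      then have "d (block 0 x) = 0" "e (block 0 x) = 0"
        using d e by (simp_all add: Der_iff)
      moreover have "qmap d x = 0" "qmap e x = 0"
        using False qmap_Der [OF d] qmap_Der [OF e] by (simp_all add: Der_iff)
      ultimately show ?thesis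
        using Der_0 [OF lie_algebra_poincare d] Der_0 [OF lie_algebra_poincare e]
          Der_0 [OF lie_algebra_o4 qmap_Der [OF d]] Der_0 [OF lie_algebra_o4 qmap_Der [OF e]]
        by (simp add: qmap_def Der_simps mat_part_simps)
    qed
  qed
  then show ?thesis
    unfolding lie_hom_def linear_map_on_def
    by (intro conjI ballI allI ext lie_algebra_Der lie_algebra_poincare lie_algebra_o4 qmap_Der)
      (simp_all add: qmap_def Der_simps mat_part_simps)
qed

text \<open>Away from characteristic 2, the value of a cocycle on \<open>skew_unit i j\<close> is confined to the
  coordinates \<open>i\<close> and \<open>j\<close> by comparison with the complementary \<open>skew_unit k l\<close>. In characteristic 2,
  the identity matrix is a central element of \<open>o4\<close> which acts invertibly.\<close>

lemma o4_cocycle_coboundary: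
  fixes c :: "'a::field^4^4 \<Rightarrow> 'a^4"
  assumes add: "\<And>x y. \<lbrakk>x \<in> carr o4; y \<in> carr o4\<rbrakk> \<Longrightarrow> c (x + y) = c x + c y"
    and scl: "\<And>a x. x \<in> carr o4 \<Longrightarrow> c (scl o4 a x) = a *s c x"
    and cocycle: "\<And>x y. \<lbrakk>x \<in> carr o4; y \<in> carr o4\<rbrakk> \<Longrightarrow> c (brk o4 x y) = c x v* y - c y v* x"
  shows "\<exists>v0. \<forall>x\<in>carr o4. c x = v0 v* x"
proof -
  interpret o4: lie_algebra "o4 :: ('a, 'a^4^4) lie_alg" by (rule lie_algebra_o4)
  have c0: "c 0 = 0"
    using add [of 0 0] o4.carr_0 by simp
  show ?thesis
  proof (cases "(2::'a) = 0")
    case True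
    \<comment> \<open>The cocycle identity for [x, 1] = 0 reads 0 = c x - c(1) x.\<close>
    have "c x = c (mat 1) v* x" if "x \<in> carr o4" for x
      using cocycle [OF that mat_in_o4 [OF True], of 1] c0 by (simp add: brk_o4_mat)
    then show ?thesis
      by blast
  next
    case two: False
    have support: "c (skew_unit i j) $ k = 0" if "k \<noteq> i" "k \<noteq> j" for i j k
    proof -
      obtain l where l: "l \<noteq> i" "l \<noteq> j" "l \<noteq> k"
        using fourth_index by blast
      then have "brk o4 (skew_unit i j) (skew_unit k l) = (0 :: 'a^4^4)"
        using that by (auto simp: vec_eq_iff brk_skew_unit_component skew_unit_component)
      then have "c (skew_unit i j) v* skew_unit k l - c (skew_unit k l) v* skew_unit i j = 0"
        using cocycle c0 by (metis skew_unit_o4)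
      then have "(c (skew_unit i j) v* skew_unit k l - c (skew_unit k l) v* skew_unit i j) $ l = 0"
        by simp
      then show ?thesis
        using l that by (simp add: vec_mult_skew_unit)
    qed
    \<comment> \<open>Coordinate k of the cocycle identity for [e_ij, e_jk] = e_ik, where e_ij
      stands for \<open>skew_unit i j\<close>.\<close>
    have indep: "c (skew_unit i j) $ j = c (skew_unit i k) $ k"
      if "i \<noteq> j" "i \<noteq> k" "j \<noteq> k" for i j k
    proof -
      have "brk o4 (skew_unit i j) (skew_unit j k) = (skew_unit i k :: 'a^4^4)"
        using that by (auto simp: vec_eq_iff brk_skew_unit_component skew_unit_component)
      then have "c (skew_unit i k) = c (skew_unit i j) v* skew_unit j k - c (skew_unit j k) v* skew_unit i j"
        using cocycle by (metis skew_unit_o4)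
      then show ?thesis
        using that by (simp add: vec_mult_skew_unit)
    qed
    \<comment> \<open>Addition on the index type is modulo 4, so \<open>i + 1\<close> is merely some
      index other than i; by \<open>indep\<close> the choice is immaterial.\<close>
    define v0 where "v0 = (\<chi> i. c (skew_unit i (i + 1)) $ (i + 1))"
    have v0: "c (skew_unit i j) $ j = v0 $ i" if "i \<noteq> j" for i j
    proof -
      have "i \<noteq> i + 1"
        by simp
      then show ?thesis
        using that indep [of i j "i + 1"] by (cases "j = i + 1") (auto simp: v0_def)
    qed
    have neg: "c (- x) = - c x" if "x \<in> carr o4" for x
      using add [OF that o4.carr_uminus [OF that]] c0 by (simp add: eq_neg_iff_add_eq_0 add.commute)
    have unit: "c (skew_unit i j) = v0 v* skew_unit i j" if "i \<noteq> j" for i j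
    proof -
      have "c (skew_unit i j) $ i = - (v0 $ j)"
        using v0 [of j i, symmetric] that neg [of "skew_unit i j"] by (simp add: skew_unit_swap [of j i])
      then show ?thesis
        using that support v0 by (auto simp: vec_eq_iff vec_mult_skew_unit)
    qed
    have "c x = v0 v* x" if "x \<in> carr o4" for x
      using two that
    proof (induction rule: o4_induct)
      case (scl a x)
      have "v0 v* scl o4 a x = a *s (v0 v* x)"
        by (simp add: o4_simps vec_eq_iff vector_matrix_mult_def sum_distrib_left mult_ac)
      with scl show ?case
        using assms(2) by simp
    qed (simp_all add: add unit vector_matrix_mult_add_rdistrib)
    then show ?thesis
      by blast
  qed
qed

text \<open>The coordinate vector e_k is killed by \<open>skew_unit i j\<close> when i and j differ
  from k, hence so is g e_k, and this leaves only its coordinate k. As \<open>skew_unit 1 j\<close>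
  sends e_1 to e_j, the resulting scalars agree. Equivariance is asked for the elementary matrices
  alone: in \<open>qmap_scalar_eq_0\<close> it is known for these before it is known for all of
  \<open>o4\<close>.\<close>

lemma o4_equivariant_scalar:
  fixes g :: "'a::field^4 \<Rightarrow> 'a^4"
  assumes add: "\<And>u v. g (u + v) = g u + g v" and scl: "\<And>a v. g (a *s v) = a *s g v"
    and equivariant: "\<And>i j v. g (v v* skew_unit i j) = g v v* skew_unit i j"
  shows "\<exists>l. \<forall>v. g v = l *s v"
proof -
  have g0: "g 0 = 0"
    using add [of 0 0] by simp
  have g_axis: "g (axis k 1) $ i = 0" if "i \<noteq> k" for i k
  proof -
    obtain j where j: "j \<noteq> i" "j \<noteq> k"
      using fourth_index by blast
    have "axis k 1 v* skew_unit i j = (0 :: 'a^4)"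
      using j that by (simp add: vec_eq_iff vec_mult_skew_unit axis_def)
    then have "(g (axis k 1) v* skew_unit i j) $ j = 0"
      using equivariant [of "axis k 1" i j] g0 by simp
    then show ?thesis
      using j by (simp add: vec_mult_skew_unit)
  qed
  define l where "l = g (axis 1 1) $ 1"
  have g_axis': "g (axis j 1) = l *s axis j 1" for j
  proof (cases "j = 1")
    case True
    then show ?thesis
      using g_axis [of _ 1] by (auto simp: vec_eq_iff axis_def l_def)
  next
    case False
    have "axis 1 1 v* skew_unit 1 j = (axis j 1 :: 'a^4)"
      using False by (simp add: vec_eq_iff vec_mult_skew_unit axis_def)
    then have "g (axis j 1) = g (axis 1 1) v* skew_unit 1 j"
      using equivariant [of "axis 1 1" 1 j] by simp
    then show ?thesis
      using False g_axis [of _ j] by (auto simp: vec_eq_iff axis_def vec_mult_skew_unit l_def)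
  qed
  have "g v = l *s v" for v
  proof -
    have "g v = g (\<Sum>k\<in>UNIV. v $ k *s axis k 1)"
      by (simp add: basis_expansion)
    also have "\<dots> = l *s (\<Sum>k\<in>UNIV. v $ k *s axis k 1)"
      by (simp add: sum_4 add scl g_axis' vec_eq_iff algebra_simps)
    finally show ?thesis
      by (simp add: basis_expansion)
  qed
  then show ?thesis
    by blast
qed

lemma qmap_kernel:
  fixes d :: "'a::field mat5 \<Rightarrow> 'a mat5"
  assumes d: "d \<in> carr (Der poincare)" and q: "qmap d = 0"
  shows "d \<in> range dmap"
proof -
  interpret o4: lie_algebra "o4 :: ('a, 'a^4^4) lie_alg" by (rule lie_algebra_o4)
  define D where "D v M = row_part (d (block v M))" for v M
  have dD: "d (block v M) = block (D v M) 0" if M: "M \<in> carr o4" for v M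
  proof -
    have "d (block v M) \<in> carr poincare"
      using d M by (simp add: Der_iff)
    moreover have "mat_part (d (block v M)) = 0"
      using qmap_mat_part [OF d, of "block v M"] M q by simp
    ultimately show ?thesis
      using poincare_parts(2) [of "d (block v M)"] by (simp add: D_def)
  qed
  have D_add: "D (v + w) (M + N) = D v M + D w N" if "M \<in> carr o4" "N \<in> carr o4" for v w M N
    using d that by (simp add: D_def Der_iff row_part_simps flip: block_add)
  have D_scl: "D (a *s v) (scl o4 a M) = a *s D v M" if "M \<in> carr o4" for a v M
    using d that by (simp add: D_def Der_iff row_part_simps flip: block_scl)
  \<comment> \<open>Both conditions on d are contained here: v = w = 0 gives the cocycle identity on
    \<open>o4\<close>, while M = 0 and w = 0 gives equivariance on the translations.\<close>
  have D_brk: "D (v v* N - w v* M) (brk o4 M N) = D v M v* N - D w N v* M"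
    if "M \<in> carr o4" "N \<in> carr o4" for v w M N
  proof -
    have "d (brk poincare (block v M) (block w N))
        = brk poincare (d (block v M)) (block w N) + brk poincare (block v M) (d (block w N))"
      using d that by (simp add: Der_iff)
    then have "d (block (v v* N - w v* M) (brk o4 M N))
        = brk poincare (block (D v M) 0) (block w N) + brk poincare (block v M) (block (D w N) 0)"
      using that by (simp add: dD brk_poincare_block)
    then show ?thesis
      by (simp add: D_def [of "v v* N - w v* M"] brk_poincare_block block_add)
  qed
  have "\<exists>v0. \<forall>x\<in>carr o4. D 0 x = v0 v* x"
  proof (rule o4_cocycle_coboundary)
    show "D 0 (x + y) = D 0 x + D 0 y" if "x \<in> carr o4" "y \<in> carr o4" for x y
      using D_add [of x y 0 0] that by simp
    show "D 0 (scl o4 a x) = a *s D 0 x" if "x \<in> carr o4" for a x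
      using D_scl [of x a 0] that by simp
    show "D 0 (brk o4 x y) = D 0 x v* y - D 0 y v* x" if "x \<in> carr o4" "y \<in> carr o4" for x y
      using D_brk [of x y 0 0] that by simp
  qed
  then obtain v0 where v0: "\<And>x. x \<in> carr o4 \<Longrightarrow> D 0 x = v0 v* x"
    by blast
  have "\<exists>l. \<forall>v. D v 0 = l *s v"
  proof (rule o4_equivariant_scalar)
    show "D (u + v) 0 = D u 0 + D v 0" for u v
      using D_add [of 0 0 u v] o4.carr_0 by simp
    show "D (a *s v) 0 = a *s D v 0" for a v
      using D_scl [of 0 a v] o4.carr_0 by simp
    show "D (v v* skew_unit i j) 0 = D v 0 v* skew_unit i j" for i j v
      using D_brk [of 0 "skew_unit i j" v 0] o4.carr_0 o4.brk_zero_left by simp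
  qed
  then obtain l where l: "\<And>v. D v 0 = l *s v"
    by blast
  have "d X = dmap (l, v0) X" for X
  proof (cases "X \<in> carr poincare")
    case True
    then obtain v M where X: "X = block v M" "M \<in> carr o4"
      by (rule poincareE)
    have "D v M = l *s v + v0 v* M"
      using D_add [of 0 M v 0] X o4.carr_0 l v0 by simp
    then show ?thesis
      using X dD by (simp add: dmap_def)
  next
    case False
    then show ?thesis
      using d by (simp add: dmap_def Der_iff)
  qed
  then show ?thesis
    by blast
qed

lemma dmap_Der: "dmap p \<in> carr (Der (poincare :: ('a::field, 'a mat5) lie_alg))"
proof -
  interpret p: lie_algebra "poincare :: ('a, 'a mat5) lie_alg" by (rule lie_algebra_poincare)
  interpret o4: lie_algebra "o4 :: ('a, 'a^4^4) lie_alg" by (rule lie_algebra_o4)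
  obtain l v0 where p: "p = (l, v0)"
    by (cases p)
  show ?thesis
    unfolding Der_iff p
  proof (intro conjI ballI allI impI)
    fix X Y :: "'a mat5" assume X: "X \<in> carr poincare" and Y: "Y \<in> carr poincare"
    show "dmap (l, v0) X \<in> carr poincare"
      using X o4.carr_0 by (simp add: dmap_def)
    show "dmap (l, v0) (X + Y) = dmap (l, v0) X + dmap (l, v0) Y"
      using X Y by (simp add: dmap_def p.carr_add row_part_simps mat_part_simps block_add
        vector_matrix_mult_add_rdistrib vector_add_ldistrib algebra_simps)
    obtain v M w N where *: "X = block v M" "M \<in> carr o4" "Y = block w N" "N \<in> carr o4"
      using X Y by (metis poincareE)
    have "v0 v* brk o4 M N = (v0 v* M) v* N - (v0 v* N) v* M"
      by (simp add: o4_simps vector_matrix_mul_assoc vector_matrix_mult_diff_rdistrib)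
    then show "dmap (l, v0) (brk poincare X Y)
        = brk poincare (dmap (l, v0) X) Y + brk poincare X (dmap (l, v0) Y)"
      using * by (simp add: dmap_def brk_poincare_block o4.brk_closed o4.brk_zero_left
        o4.brk_zero_right block_add scalar_vector_matrix_assoc algebra_simps vector_ssub_ldistrib)
  next
    fix c and X :: "'a mat5" assume X: "X \<in> carr poincare"
    have "v0 v* scl o4 c (mat_part X) = c *s (v0 v* mat_part X)"
      by (simp add: o4_simps vec_eq_iff vector_matrix_mult_def sum_distrib_left mult_ac)
    moreover have "scl o4 c 0 = (0 :: 'a^4^4)"
      by simp
    ultimately show "dmap (l, v0) (scl poincare c X) = scl poincare c (dmap (l, v0) X)"
      using X by (simp add: dmap_def p.carr_scl row_part_simps mat_part_simps block_scl
         vector_add_ldistrib vector_smult_assoc mult.commute)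
  qed (simp add: dmap_def)
qed

lemma lie_mono_dmap:
  "lie_mono scal_vec (Der poincare) (dmap :: 'a::field \<times> ('a^4) \<Rightarrow> 'a mat5 \<Rightarrow> 'a mat5)"
proof -
  interpret p: lie_algebra "poincare :: ('a, 'a mat5) lie_alg" by (rule lie_algebra_poincare)
  interpret o4: lie_algebra "o4 :: ('a, 'a^4^4) lie_alg" by (rule lie_algebra_o4)
  note z = o4.carr_0 p.carr_0
  have add: "dmap (p + q) X = (dmap p + dmap q) X" for p q :: "'a \<times> ('a^4)" and X
    by (cases p; cases q) (simp add: dmap_def block_add algebra_simps)
  have scl: "dmap (scl scal_vec c p) X = scl (Der poincare) c (dmap p) X" for c :: 'a and p X
    by (cases p) (simp add: scal_vec_def dmap_def block_scl scalar_vector_matrix_assoc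
        vector_add_ldistrib vector_smult_assoc Der_simps)
  have brk: "dmap (brk scal_vec p q) X = brk (Der poincare) (dmap p) (dmap q) X"
    for p q :: "'a \<times> ('a^4)" and X
    using z by (cases p; cases q) (simp add: scal_vec_def dmap_def Der_simps block_add
      scalar_vector_matrix_assoc vector_add_ldistrib vector_smult_assoc algebra_simps
      mat_part_simps(1) row_part_simps(1))
  have "lie_hom scal_vec (Der poincare) (dmap :: 'a \<times> ('a^4) \<Rightarrow> 'a mat5 \<Rightarrow> 'a mat5)"
    unfolding lie_hom_def linear_map_on_def
    by (intro conjI ballI allI ext add scl brk lie_algebra_scal_vec lie_algebra_Der
        lie_algebra_poincare dmap_Der)
  moreover have "inj (dmap :: 'a \<times> ('a^4) \<Rightarrow> 'a mat5 \<Rightarrow> 'a mat5)"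
  proof (rule injI)
    fix p q :: "'a \<times> ('a^4)"
    assume eq: "dmap p = dmap q"
    obtain l v m w where pq: "p = (l, v)" "q = (m, w)"
      by (cases p; cases q)
    \<comment> \<open>The scalar is detected on a translation, the vector on the matrices
      \<open>skew_unit i j\<close>.\<close>
    have "l *s axis 1 1 = m *s (axis 1 1 :: 'a^4)"
      using fun_cong [OF eq, of "block (axis 1 1) 0"] z by (simp add: pq dmap_def)
    then have "(l *s axis 1 1) $ 1 = (m *s (axis 1 1 :: 'a^4)) $ 1"
      by simp
    then have "l = m"
      by simp
    have "v v* skew_unit i j = w v* skew_unit i j" for i j
      using fun_cong [OF eq, of "block 0 (skew_unit i j)"] by (simp add: pq dmap_def)
    then have *: "(v v* skew_unit i j) $ j = (w v* skew_unit i j) $ j" for i j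
      by simp
    have "v $ i = w $ i" for i
      using * [of i "i + 1"] by (simp add: vec_mult_skew_unit)
    with \<open>l = m\<close> show "p = q"
      by (simp add: pq vec_eq_iff)
  qed
  ultimately show ?thesis
    by (simp add: lie_mono_def scal_vec_def)
qed

section \<open>Self-dual decomposition of \<open>o4\<close>\<close>

text \<open>For \<open>s = 1\<close> and \<open>s = -1\<close>, the images of \<open>so3 s\<close> are the self-dual and the anti-self-dual part
  of \<open>o4\<close>, in coordinates for which the bracket is the cross product.\<close>

definition so3 :: "'a::field \<Rightarrow> 'a \<Rightarrow> 'a \<Rightarrow> 'a \<Rightarrow> 'a^4^4"
  where "so3 s a b c = (\<chi> i j. - (s * a * skew_unit 1 2 $ i $ j + a * skew_unit 3 4 $ i $ j
    + s * b * skew_unit 1 3 $ i $ j - b * skew_unit 2 4 $ i $ j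
    + s * c * skew_unit 1 4 $ i $ j + c * skew_unit 2 3 $ i $ j) / 2)"

lemma so3_component:
  "so3 s a b c $ 1 $ 1 = 0" "so3 s a b c $ 1 $ 2 = - (s * a / 2)"
  "so3 s a b c $ 1 $ 3 = - (s * b / 2)" "so3 s a b c $ 1 $ 4 = - (s * c / 2)"
  "so3 s a b c $ 2 $ 1 = s * a / 2" "so3 s a b c $ 2 $ 2 = 0"
  "so3 s a b c $ 2 $ 3 = - (c / 2)" "so3 s a b c $ 2 $ 4 = b / 2"
  "so3 s a b c $ 3 $ 1 = s * b / 2" "so3 s a b c $ 3 $ 2 = c / 2"
  "so3 s a b c $ 3 $ 3 = 0" "so3 s a b c $ 3 $ 4 = - (a / 2)"
  "so3 s a b c $ 4 $ 1 = s * c / 2" "so3 s a b c $ 4 $ 2 = - (b / 2)"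
  "so3 s a b c $ 4 $ 3 = a / 2" "so3 s a b c $ 4 $ 4 = 0"
  for s :: "'a::field"
  by (simp_all add: so3_def skew_unit_component)

lemma so3_in_o4 [simp]: "so3 s a b c \<in> carr o4"
  by (simp add: o4_iff forall_4 so3_component)

lemma so3_add: "so3 s a b c + so3 s a' b' c' = so3 s (a + a') (b + b') (c + c')"
  by (simp add: vec_eq_iff forall_4 so3_component algebra_simps add_divide_distrib)

lemma so3_scl: "scl o4 r (so3 s a b c) = so3 s (r * a) (r * b) (r * c)"
  by (simp add: vec_eq_iff forall_4 so3_component o4_simps mult.left_commute)

lemma so3_uminus: "- so3 s a b c = so3 s (- a) (- b) (- c)"
  by (simp add: vec_eq_iff forall_4 so3_component)

lemma so3_0: "so3 s 0 0 0 = 0"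
  by (simp add: vec_eq_iff forall_4 so3_component)

text \<open>Clearing the halves in products of \<open>so3\<close> matrices produces these powers of
  2 as factors to be cancelled.\<close>

lemma numeral_power_2_nonzero:
  assumes "(2::'a::field) \<noteq> 0"
  shows "(4::'a) \<noteq> 0" "(8::'a) \<noteq> 0" "(16::'a) \<noteq> 0" "(32::'a) \<noteq> 0"
  using assms power_not_zero [of "2::'a" 2] power_not_zero [of "2::'a" 3]
    power_not_zero [of "2::'a" 4] power_not_zero [of "2::'a" 5] by simp_all

text \<open>The signs and the division by 2 in \<open>so3\<close> are normalised for this formula;
  without the division the cross product would appear with an extra factor 2.\<close>

lemma brk_so3_same:
  fixes s :: "'a::field"
  assumes "(2::'a) \<noteq> 0" "s = 1 \<or> s = - 1"
  shows "brk o4 (so3 s a b c) (so3 s a' b' c')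
    = so3 s (b * c' - c * b') (c * a' - a * c') (a * b' - b * a')"
proof -
  note numeral_power_2_nonzero [OF assms(1)]
  then show ?thesis
    using assms
    by (auto simp: vec_eq_iff forall_4 so3_component o4_simps matrix_matrix_mult_def sum_4 field_simps)
qed

lemma brk_so3_opposite:
  fixes s :: "'a::field"
  assumes "s = 1 \<or> s = - 1"
  shows "brk o4 (so3 s a b c) (so3 (- s) a' b' c') = 0"
  using assms
  by (auto simp: vec_eq_iff forall_4 so3_component o4_simps matrix_matrix_mult_def sum_4
      mult.commute)

text \<open>The coordinates are read off in pairs: of two suitable entries, one is half of a + d and
  the other half of s (a - d), and likewise for b, e and c, f. Sum and difference determine the pair
  because 2 is nonzero.\<close>

lemma so3_sum_eq_iff:
  fixes s :: "'a::field"
  assumes two: "(2::'a) \<noteq> 0" and s: "s = 1 \<or> s = - 1"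
  shows "so3 s a b c + so3 (- s) d e f = so3 s a' b' c' + so3 (- s) d' e' f' \<longleftrightarrow>
    a = a' \<and> b = b' \<and> c = c' \<and> d = d' \<and> e = e' \<and> f = f'" (is "?l \<longleftrightarrow> ?r")
proof
  assume ?l
  then have eq: "(so3 s a b c + so3 (- s) d e f) $ i $ j = (so3 s a' b' c' + so3 (- s) d' e' f') $ i $ j" for i j
    by simp
  have *: "x = x' \<and> y = y'" if "2 * (x + y) = 2 * (x' + y')" "2 * (x - y) = 2 * (x' - y')"
    for x y x' y' :: 'a
  proof -
    have "4 * x = 2 * (x + y) + 2 * (x - y)"
      by simp
    also have "\<dots> = 2 * (x' + y') + 2 * (x' - y')"
      by (simp only: that)
    finally have "4 * x = 4 * x'"
      by simp
    then have "x = x'"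
      using numeral_power_2_nonzero [OF two] by simp
    with that(1) two show ?thesis
      by simp
  qed
  have "2 * (a + d) = 2 * (a' + d')" "2 * (a - d) = 2 * (a' - d')"
    using eq [of 4 3] eq [of 2 1] s two by (auto simp: so3_component field_simps)
  moreover have "2 * (b + e) = 2 * (b' + e')" "2 * (b - e) = 2 * (b' - e')"
    using eq [of 2 4] eq [of 3 1] s two by (auto simp: so3_component field_simps)
  moreover have "2 * (c + f) = 2 * (c' + f')" "2 * (c - f) = 2 * (c' - f')"
    using eq [of 3 2] eq [of 4 1] s two by (auto simp: so3_component field_simps)
  ultimately show ?r
    using * by blast
qed simp

lemma so3_eq_iff:
  fixes s :: "'a::field"
  assumes "(2::'a) \<noteq> 0" "s = 1 \<or> s = - 1"
  shows "so3 s a b c = so3 s a' b' c' \<longleftrightarrow> a = a' \<and> b = b' \<and> c = c'"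
  using so3_sum_eq_iff [OF assms, of a b c 0 0 0 a' b' c' 0 0 0] by (simp add: so3_0)

lemma o4_so3_decomp:
  fixes M :: "'a::field^4^4"
  assumes two: "(2::'a) \<noteq> 0" and s: "s = 1 \<or> s = - 1" and M: "M \<in> carr o4"
  obtains a b c d e f where "M = so3 s a b c + so3 (- s) d e f"
proof -
  have sk: "M $ 2 $ 1 = - (M $ 1 $ 2)" "M $ 3 $ 1 = - (M $ 1 $ 3)" "M $ 4 $ 1 = - (M $ 1 $ 4)"
     "M $ 3 $ 2 = - (M $ 2 $ 3)" "M $ 4 $ 2 = - (M $ 2 $ 4)" "M $ 4 $ 3 = - (M $ 3 $ 4)"
    using M o4_iff by blast+
  \<comment> \<open>With Mij for the entries, the coefficients solve a + d = 2 M43 and a - d = 2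
    M21, then b + e = 2 M24 and b - e = 2 M31, then c + f = 2 M32 and c - f = 2 M41. For s = -1 the
    two summands change places.\<close>
  have "M = so3 1 (- M $ 1 $ 2 - M $ 3 $ 4) (M $ 2 $ 4 - M $ 1 $ 3) (- M $ 1 $ 4 - M $ 2 $ 3)
      + so3 (- 1) (M $ 1 $ 2 - M $ 3 $ 4) (M $ 2 $ 4 + M $ 1 $ 3) (M $ 1 $ 4 - M $ 2 $ 3)"
    using two numeral_power_2_nonzero [OF two]
    by (simp add: vec_eq_iff forall_4 so3_component sk o4_diag [OF two M] field_simps)
  then show thesis
    using s that by (metis add.commute minus_minus)
qed

section \<open>Derivations and ideals of \<open>o4\<close> in self-dual coordinates\<close>

text \<open>Each of the two parts absorbs brackets with all of \<open>o4\<close> and is spanned by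
  brackets of its own elements, so D maps it into itself. On the basis Y1, Y2, Y3 with the cross
  product, the Leibniz rule makes the matrix of D skew-symmetric, and a skew 3 x 3 matrix is the
  cross product with a vector.\<close>

lemma Der_so3:
  fixes D :: "'a::field^4^4 \<Rightarrow> 'a^4^4"
  assumes two: "(2::'a) \<noteq> 0" and s: "s = 1 \<or> s = - 1" and D: "D \<in> carr (Der o4)"
  obtains a b c where "\<And>p q r. D (so3 s p q r) = brk o4 (so3 s a b c) (so3 s p q r)"
proof -
  interpret o4: lie_algebra "o4 :: ('a, 'a^4^4) lie_alg" by (rule lie_algebra_o4)
  note brk = brk_so3_same [OF two s]
  have D': "D (brk o4 x y) = brk o4 (D x) y + brk o4 x (D y)" "D (x + y) = D x + D y"
    if "x \<in> carr o4" "y \<in> carr o4" for x y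
    using D that by (simp_all add: Der_iff)
  have D'': "D (scl o4 t x) = scl o4 t (D x)" "D x \<in> carr o4" if "x \<in> carr o4" for x t
    using D that by (simp_all add: Der_iff)
  have absorb: "\<exists>a b c. brk o4 M (so3 s p q r) = so3 s a b c" if "M \<in> carr o4" for M p q r
  proof -
    obtain a b c d e f where M: "M = so3 s a b c + so3 (- s) d e f"
      using o4_so3_decomp [OF two s \<open>M \<in> carr o4\<close>] .
    have "brk o4 (so3 (- s) d e f) (so3 s p q r) = 0"
      using brk_so3_opposite [of "- s" d e f p q r] s by (auto simp: minus_equation_iff)
    then have "brk o4 M (so3 s p q r) = brk o4 (so3 s a b c) (so3 s p q r)"
      by (simp add: M o4.brk_add_left)
    then show ?thesis
      by (metis brk)
  qed
  have stable: "\<exists>a b c. D (brk o4 (so3 s p q r) (so3 s p' q' r')) = so3 s a b c" for p q r p' q' r'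
  proof -
    obtain a b c where 1: "brk o4 (D (so3 s p q r)) (so3 s p' q' r') = so3 s a b c"
      using absorb D''(2) so3_in_o4 by metis
    obtain d e f where 2: "brk o4 (D (so3 s p' q' r')) (so3 s p q r) = so3 s d e f"
      using absorb D''(2) so3_in_o4 by metis
    have "brk o4 (so3 s p q r) (D (so3 s p' q' r')) = so3 s (- d) (- e) (- f)"
      using o4.brk_anticomm [of "D (so3 s p' q' r')" "so3 s p q r"] 2 D''(2) by (simp add: so3_uminus)
    then show ?thesis
      using 1 by (auto simp: D'(1) so3_add)
  qed
  define Y1 Y2 Y3 where Y_def: "Y1 = so3 s 1 0 0" "Y2 = so3 s 0 1 0" "Y3 = so3 s 0 0 1"
  have Y: "brk o4 Y2 Y3 = Y1" "brk o4 Y3 Y1 = Y2" "brk o4 Y1 Y2 = Y3"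
    by (simp_all add: Y_def brk)
  obtain a1 b1 c1 where 1: "D Y1 = so3 s a1 b1 c1"
    using stable [of 0 1 0 0 0 1] Y(1) by (auto simp: Y_def)
  obtain a2 b2 c2 where 2: "D Y2 = so3 s a2 b2 c2"
    using stable [of 0 0 1 1 0 0] Y(2) by (auto simp: Y_def)
  obtain a3 b3 c3 where 3: "D Y3 = so3 s a3 b3 c3"
    using stable [of 1 0 0 0 1 0] Y(3) by (auto simp: Y_def)
  have "so3 s a1 b1 c1 = brk o4 (D Y2) Y3 + brk o4 Y2 (D Y3)"
    using D'(1) [of Y2 Y3] Y 1 by (simp add: Y_def)
  then have eqs1: "a1 = b2 + c3" "b1 = - a2" "c1 = - a3"
    unfolding 2 3 by (simp_all add: Y_def brk so3_add so3_eq_iff [OF two s] add.commute)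
  have "so3 s a2 b2 c2 = brk o4 (D Y3) Y1 + brk o4 Y3 (D Y1)"
    using D'(1) [of Y3 Y1] Y 2 by (simp add: Y_def)
  then have eqs2: "b2 = c3 + a1" "c2 = - b3"
    unfolding 1 3 by (simp_all add: Y_def brk so3_add so3_eq_iff [OF two s] add.commute)
  have "so3 s a3 b3 c3 = brk o4 (D Y1) Y2 + brk o4 Y1 (D Y2)"
    using D'(1) [of Y1 Y2] Y 3 by (simp add: Y_def)
  then have eqs3: "c3 = a1 + b2"
    unfolding 1 2 by (simp_all add: Y_def brk so3_add so3_eq_iff [OF two s] add.commute)
  \<comment> \<open>The diagonal satisfies a1 = b2 + c3, b2 = c3 + a1 and c3 = a1 + b2; where 2 is
    nonzero, only zero solves this.\<close>
  have "a1 + 2 * c3 = (c3 + a1) + c3"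
    by simp
  also have "\<dots> = a1"
    using eqs1(1) eqs2(1) by metis
  finally have "c3 = 0"
    using two by simp
  moreover from this have "b2 = a1"
    using eqs2(1) by simp
  moreover from calculation have "2 * a1 = 0"
    using eqs3 by simp
  ultimately have diag: "a1 = 0" "b2 = 0" "c3 = 0"
    using two by simp_all
  show thesis
  proof
    fix p q r
    have "so3 s p q r = scl o4 p Y1 + scl o4 q Y2 + scl o4 r Y3"
      by (simp add: Y_def so3_scl so3_add)
    then have "D (so3 s p q r) = scl o4 p (D Y1) + scl o4 q (D Y2) + scl o4 r (D Y3)"
      by (simp add: D' D'' o4.carr_scl o4.carr_add Y_def)
    \<comment> \<open>For a vector u, the cross products with the first two unit vectors are (0, u3,
      - u2) and (- u3, 0, u1). Comparison with D Y1 and D Y2 gives u = (c2, a3, b1), as c1 = -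
      a3.\<close>
    then show "D (so3 s p q r) = brk o4 (so3 s c2 a3 b1) (so3 s p q r)"
      unfolding 1 2 3 by (simp add: brk so3_scl so3_add so3_eq_iff [OF two s] eqs1(2,3) eqs2(2) diag algebra_simps)
  qed
qed

lemma Der_o4_inner:
  fixes D :: "'a::field^4^4 \<Rightarrow> 'a^4^4"
  assumes two: "(2::'a) \<noteq> 0" and D: "D \<in> carr (Der o4)"
  obtains x where "x \<in> carr o4" "D = ad o4 x"
proof -
  interpret o4: lie_algebra "o4 :: ('a, 'a^4^4) lie_alg" by (rule lie_algebra_o4)
  obtain a b c where 1: "\<And>p q r. D (so3 1 p q r) = brk o4 (so3 1 a b c) (so3 1 p q r)"
    using Der_so3 [OF two _ D, of 1] by auto
  obtain d e f where 2: "\<And>p q r. D (so3 (- 1) p q r) = brk o4 (so3 (- 1) d e f) (so3 (- 1) p q r)"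
    using Der_so3 [OF two _ D, of "- 1"] by auto
  show thesis
  proof
    show x: "so3 1 a b c + so3 (- 1) d e f \<in> carr o4"
      by (simp add: o4.carr_add)
    show "D = ad o4 (so3 1 a b c + so3 (- 1) d e f)"
    proof
      fix M
      show "D M = ad o4 (so3 1 a b c + so3 (- 1) d e f) M"
      proof (cases "M \<in> carr o4")
        case True
        obtain p q r p' q' r' where M: "M = so3 1 p q r + so3 (- 1) p' q' r'"
          using o4_so3_decomp [OF two disjI1 [OF refl] True] by blast
        have "D M = D (so3 1 p q r) + D (so3 (- 1) p' q' r')"
          using D by (simp add: M Der_iff)
        then show ?thesis
          using True x brk_so3_opposite [of "1::'a"] brk_so3_opposite [of "- 1::'a"]
          by (simp add: ad_def M 1 2 o4.brk_add_left o4.brk_add_right)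
      next
        case False
        then show ?thesis
          using D by (simp add: ad_def Der_iff)
      qed
    qed
  qed
qed

lemma inj_on_ad_o4:
  assumes two: "(2::'a::field) \<noteq> 0"
  shows "inj_on (ad (o4 :: ('a, 'a^4^4) lie_alg)) (carr o4)"
proof (rule inj_onI)
  interpret o4: lie_algebra "o4 :: ('a, 'a^4^4) lie_alg" by (rule lie_algebra_o4)
  fix x y :: "'a^4^4" assume x: "x \<in> carr o4" and y: "y \<in> carr o4" and eq: "ad o4 x = ad o4 y"
  have "x - y = 0"
  proof (rule o4_centralizer_eq_0 [OF two o4.carr_diff [OF x y]])
    fix i j
    have "brk o4 x (skew_unit i j) = brk o4 y (skew_unit i j)"
      using fun_cong [OF eq, of "skew_unit i j"] by (simp add: ad_def)
    then have "brk o4 (x - y) (skew_unit i j) = 0"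
      using x y by (simp add: o4.brk_diff_left)
    then show "brk o4 (skew_unit i j) (x - y) = 0"
      using o4.brk_anticomm [OF o4.carr_diff [OF x y], of "skew_unit i j"] by simp
  qed
  then show "x = y" by simp
qed

lemma bij_betw_ad_o4:
  assumes two: "(2::'a::field) \<noteq> 0"
  shows "bij_betw (ad (o4 :: ('a, 'a^4^4) lie_alg)) (carr o4) (carr (Der o4))"
proof -
  have "ad o4 ` carr (o4 :: ('a, 'a^4^4) lie_alg) = carr (Der o4)"
    using ad_Der [OF lie_algebra_o4] Der_o4_inner [OF two] by blast
  then show ?thesis
    by (simp add: bij_betw_def inj_on_ad_o4 [OF two])
qed

text \<open>Some component of x, say the one in part s, is nonzero. A bracket with an element of
  part s kills the other component, so the ideal contains cross products of the nonzero component
  with arbitrary vectors, and these generate the whole part.\<close>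

lemma o4_ideal_contains_so3:
  fixes J :: "('a::field^4^4) set"
  assumes two: "(2::'a) \<noteq> 0" and J: "lie_ideal o4 J" and x: "x \<in> J" "x \<noteq> 0"
  obtains s where "s = 1 \<or> s = - 1" "\<And>p q r. so3 s p q r \<in> J"
proof -
  interpret o4: lie_algebra "o4 :: ('a, 'a^4^4) lie_alg" by (rule lie_algebra_o4)
  have J': "J \<subseteq> carr o4" "o4.subspace J" "\<And>x y. \<lbrakk>x \<in> carr o4; y \<in> J\<rbrakk> \<Longrightarrow> brk o4 x y \<in> J"
    using J by (auto simp: lie_ideal_def)
  have "x \<in> carr o4" using J' x by blast
  have *: "so3 s p q r \<in> J" if s: "s = 1 \<or> s = - 1" and x_eq: "x = so3 s a b c + so3 (- s) d e f"
    and ne: "a \<noteq> 0 \<or> b \<noteq> 0 \<or> c \<noteq> 0" for s a b c d e f p q r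
  proof -
    note brk = brk_so3_same [OF two s]
    have cross: "so3 s (v * c' - w * b') (w * a' - u * c') (u * b' - v * a') \<in> J"
      if "so3 s a' b' c' \<in> J" for u v w a' b' c'
      using J'(3) [OF so3_in_o4 that, of s u v w] by (simp add: brk)
    have scale: "so3 s (t * a') (t * b') (t * c') \<in> J" if "so3 s a' b' c' \<in> J" for t a' b' c'
      using o4.subspace_scale [OF J'(2) that, of t] by (simp add: so3_scl)
    have cross_x: "so3 s (v * c - w * b) (w * a - u * c) (u * b - v * a) \<in> J" for u v w
      using J'(3) [OF so3_in_o4 x(1), of s u v w]
      by (simp add: x_eq o4.brk_add_right brk brk_so3_opposite [OF s])
    have gen: "so3 s p q r \<in> J" if "so3 s 1 0 0 \<in> J" "so3 s 0 1 0 \<in> J" "so3 s 0 0 1 \<in> J"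
      using o4.subspace_add [OF J'(2) o4.subspace_add [OF J'(2) scale [OF that(1), of p]
        scale [OF that(2), of q]] scale [OF that(3), of r]]
      by (simp add: so3_add)
    consider "a \<noteq> 0" | "b \<noteq> 0" | "c \<noteq> 0" using ne by blast
    then show ?thesis
    proof cases
      case 1
      \<comment> \<open>With unit vectors e1, e2, e3 and y = (a, b, c), the double cross products
        are e1 x (e2 x y) = a e2 and e1 x (e3 x y) = a e3. The missing unit vector is the cross
        product of the two found. The other cases are cyclic shifts.\<close>
      have "so3 s 0 1 0 \<in> J" "so3 s 0 0 1 \<in> J"
        using scale [OF cross [OF cross_x [where u = 0 and v = 1 and w = 0], where u = 1 and v = 0 and w = 0], of "1 / a"]
          scale [OF cross [OF cross_x [where u = 0 and v = 0 and w = 1], where u = 1 and v = 0 and w = 0], of "1 / a"] 1 by simp_all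
      then show ?thesis
        using gen cross [where u = 0 and v = 1 and w = 0 and a' = 0 and b' = 0 and c' = 1] by simp
    next
      case 2
      have "so3 s 1 0 0 \<in> J" "so3 s 0 0 1 \<in> J"
        using scale [OF cross [OF cross_x [where u = 1 and v = 0 and w = 0], where u = 0 and v = 1 and w = 0], of "1 / b"]
          scale [OF cross [OF cross_x [where u = 0 and v = 0 and w = 1], where u = 0 and v = 1 and w = 0], of "1 / b"] 2 by simp_all
      then show ?thesis
        using gen cross [where u = 0 and v = 0 and w = 1 and a' = 1 and b' = 0 and c' = 0] by simp
    next
      case 3
      have "so3 s 1 0 0 \<in> J" "so3 s 0 1 0 \<in> J"
        using scale [OF cross [OF cross_x [where u = 1 and v = 0 and w = 0], where u = 0 and v = 0 and w = 1], of "1 / c"]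
          scale [OF cross [OF cross_x [where u = 0 and v = 1 and w = 0], where u = 0 and v = 0 and w = 1], of "1 / c"] 3 by simp_all
      then show ?thesis
        using gen cross [where u = 1 and v = 0 and w = 0 and a' = 0 and b' = 1 and c' = 0] by simp
    qed
  qed
  obtain a b c d e f where x_eq: "x = so3 1 a b c + so3 (- 1) d e f"
    using o4_so3_decomp [OF two disjI1 [OF refl] \<open>x \<in> carr o4\<close>] by blast
  show thesis
  proof (cases "a \<noteq> 0 \<or> b \<noteq> 0 \<or> c \<noteq> 0")
    case True
    then show ?thesis
      using * [of 1 a b c d e f] x_eq that by blast
  next
    case False
    then have "d \<noteq> 0 \<or> e \<noteq> 0 \<or> f \<noteq> 0"
      using x(2) x_eq by (auto simp: so3_0)
    moreover have "x = so3 (- 1) d e f + so3 (- (- 1)) a b c"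
      by (simp add: x_eq add.commute)
    ultimately show ?thesis
      using * [of "- 1" d e f a b c] that by blast
  qed
qed

section \<open>Identification of \<open>o4\<close> with two copies of \<open>sl2\<close>\<close>

text \<open>For i a square root of -1, these are the coordinates of a traceless M in the basis of
  Pauli matrices divided by 2 i. That basis satisfies the relations of the cross product, since the
  commutator of two consecutive Pauli matrices is 2 i times the third.\<close>

definition sl2_to_so3 :: "'a::field \<Rightarrow> 'a \<Rightarrow> 'a^2^2 \<Rightarrow> 'a^4^4"
  where "sl2_to_so3 i s M
    = so3 s (i * (M $ 1 $ 2 + M $ 2 $ 1)) (M $ 2 $ 1 - M $ 1 $ 2) (2 * i * M $ 1 $ 1)"

lemma sl2_iff: "M \<in> carr (sl2 :: ('a::field, 'a^2^2) lie_alg) \<longleftrightarrow> M $ 2 $ 2 = - (M $ 1 $ 1)"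
  by (auto simp: sl2_def matrix_lie_def trace_def sum_2 eq_neg_iff_add_eq_0 add.commute)

lemma sl2_simps:
  "scl sl2 = (\<lambda>c (A :: 'a::field^2^2). \<chi> i. c *s (A $ i))"
  "brk sl2 = (\<lambda>(A :: 'a::field^2^2) B. A ** B - B ** A)"
  by (simp_all add: sl2_def matrix_lie_def)

lemma sl2_to_so3_brk:
  fixes A B :: "'a::field^2^2"
  assumes "(2::'a) \<noteq> 0" "s = 1 \<or> s = - 1" and i: "i * i = - 1"
    and A: "A \<in> carr sl2" and B: "B \<in> carr sl2"
  shows "sl2_to_so3 i s (brk sl2 A B) = brk o4 (sl2_to_so3 i s A) (sl2_to_so3 i s B)"
proof -
  have i': "i * (i * x) = - x" for x
    using i by (simp flip: mult.assoc)
  show ?thesis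
    using A B
    by (simp add: sl2_to_so3_def brk_so3_same [OF assms(1,2)] so3_eq_iff [OF assms(1,2)] sl2_simps
        sl2_iff matrix_matrix_mult_def sum_2 i i' algebra_simps)
qed

lemma lie_isomorphic_sl2_sl2_o4:
  assumes two: "(2::'a::field) \<noteq> 0" and i: "i * i = - (1::'a)"
  shows "lie_isomorphic (lie_prod sl2 sl2 :: ('a, ('a^2^2) \<times> ('a^2^2)) lie_alg) (o4 :: ('a, 'a^4^4) lie_alg)"
proof -
  interpret o4: lie_algebra "o4 :: ('a, 'a^4^4) lie_alg" by (rule lie_algebra_o4)
  have s: "1 = (1::'a) \<or> 1 = - (1::'a)" "- 1 = (1::'a) \<or> - 1 = - (1::'a)"
    by simp_all
  have in_o4 [simp]: "sl2_to_so3 i s A \<in> carr o4" for s :: 'a and A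
    by (simp add: sl2_to_so3_def)
  define f where "f = (\<lambda>(A, B). sl2_to_so3 i 1 A + sl2_to_so3 i (- 1) B)"
  have opp: "brk o4 (sl2_to_so3 i 1 A) (sl2_to_so3 i (- 1) B) = 0"
    "brk o4 (sl2_to_so3 i (- 1) A) (sl2_to_so3 i 1 B) = 0" for A B
    using brk_so3_opposite [of "1::'a"] brk_so3_opposite [of "- 1::'a"] by (simp_all add: sl2_to_so3_def)
  have add: "sl2_to_so3 i s (A + B) = sl2_to_so3 i s A + sl2_to_so3 i s B" for s :: 'a and A B
    by (simp add: sl2_to_so3_def so3_add algebra_simps)
  have scl: "sl2_to_so3 i s (scl sl2 c A) = scl o4 c (sl2_to_so3 i s A)" for s c :: 'a and A
    by (simp add: sl2_to_so3_def so3_scl sl2_simps algebra_simps)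
  have hom: "lie_hom (lie_prod sl2 sl2) o4 f"
    unfolding lie_hom_def linear_map_on_def
  proof (intro conjI ballI allI lie_algebra_lie_prod lie_algebra_sl2 lie_algebra_o4)
    fix X Y :: "('a^2^2) \<times> ('a^2^2)" and c
    assume X: "X \<in> carr (lie_prod sl2 sl2)"
    then show "f X \<in> carr o4" "f (scl (lie_prod sl2 sl2) c X) = scl o4 c (f X)"
      by (auto simp: f_def lie_prod_def o4.carr_add scl o4.scale_right_distrib)
    assume Y: "Y \<in> carr (lie_prod sl2 sl2)"
    show "f (X + Y) = f X + f Y"
      by (simp add: f_def split_def add)
    show "f (brk (lie_prod sl2 sl2) X Y) = brk o4 (f X) (f Y)"
      using X Y by (auto simp: f_def lie_prod_def o4.brk_add_left o4.brk_add_right o4.carr_add opp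
        sl2_to_so3_brk [OF two s(1) i] sl2_to_so3_brk [OF two s(2) i])
  qed
  have "i \<noteq> 0" using i by auto
  have coord: "M = M'" if "M \<in> carr sl2" "M' \<in> carr sl2"
     "i * (M $ 1 $ 2 + M $ 2 $ 1) = i * (M' $ 1 $ 2 + M' $ 2 $ 1)"
     "M $ 2 $ 1 - M $ 1 $ 2 = M' $ 2 $ 1 - M' $ 1 $ 2" "2 * i * M $ 1 $ 1 = 2 * i * M' $ 1 $ 1"
    for M M' :: "'a^2^2"
  proof -
    have 1: "M $ 1 $ 1 = M' $ 1 $ 1" "M $ 1 $ 2 + M $ 2 $ 1 = M' $ 1 $ 2 + M' $ 2 $ 1"
      using that \<open>i \<noteq> 0\<close> two by simp_all
    have "2 * N $ 2 $ 1 = (N $ 1 $ 2 + N $ 2 $ 1) + (N $ 2 $ 1 - N $ 1 $ 2)" for N :: "'a^2^2"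
      by simp
    then have "2 * M $ 2 $ 1 = 2 * M' $ 2 $ 1"
      using 1(2) that(4) by presburger
    then have "M $ 2 $ 1 = M' $ 2 $ 1"
      using two by simp
    then show ?thesis
      using 1 that(1,2) by (simp add: vec_eq_iff forall_2 sl2_iff)
  qed
  have inj: "inj_on f (carr (lie_prod sl2 sl2))"
  proof (rule inj_onI)
    fix X Y assume "X \<in> carr (lie_prod sl2 sl2)" "Y \<in> carr (lie_prod sl2 sl2)" "f X = f Y"
    then show "X = Y"
      unfolding f_def split_def sl2_to_so3_def so3_sum_eq_iff [OF two s(1)]
      by (intro prod_eqI coord) (auto simp: lie_prod_def)
  qed
  have surj: "\<exists>A\<in>carr sl2. sl2_to_so3 i s A = so3 s a b c" for s a b c :: 'a
  proof -
    \<comment> \<open>The entries solve i (A12 + A21) = a, A21 - A12 = b and 2 i A11 = c, with A22 =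
      - A11.\<close>
    define A :: "'a^2^2" where "A = (\<chi> j k. if j = 1 then (if k = 1 then c / (2 * i) else (a / i - b) / 2)
      else (if k = 1 then (a / i + b) / 2 else - (c / (2 * i))))"
    have "A $ 2 $ 1 + A $ 1 $ 2 = a / i" "A $ 2 $ 1 - A $ 1 $ 2 = b"
      using two numeral_power_2_nonzero [OF two] by (simp_all add: A_def field_simps)
    moreover have "A \<in> carr sl2" "2 * i * A $ 1 $ 1 = c"
      using two \<open>i \<noteq> 0\<close> by (simp_all add: sl2_iff A_def)
    ultimately show ?thesis
      using \<open>i \<noteq> 0\<close> by (intro bexI [of _ A]) (simp_all add: sl2_to_so3_def add.commute)
  qed
  have "carr o4 \<subseteq> f ` carr (lie_prod sl2 sl2)"
  proof
    fix M :: "'a^4^4" assume "M \<in> carr o4"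
    then obtain a b c d e g where M: "M = so3 1 a b c + so3 (- 1) d e g"
      using o4_so3_decomp [OF two s(1)] by blast
    obtain A B where "A \<in> carr sl2" "sl2_to_so3 i 1 A = so3 1 a b c"
      "B \<in> carr sl2" "sl2_to_so3 i (- 1) B = so3 (- 1) d e g"
      using surj by metis
    then show "M \<in> f ` carr (lie_prod sl2 sl2)"
      by (intro image_eqI [of _ _ "(A, B)"]) (simp_all add: f_def M lie_prod_def)
  qed
  moreover have "f ` carr (lie_prod sl2 sl2) \<subseteq> carr o4"
    using hom by (auto simp: lie_hom_def linear_map_on_def)
  ultimately show ?thesis
    using hom inj by (auto simp: lie_isomorphic_def bij_betw_def intro!: exI [of _ f])
qed

section \<open>The split sequence and the radical\<close>

lemma qmap_dmap: "qmap (dmap p) = (0 :: 'a::field^4^4 \<Rightarrow> 'a^4^4)"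
  by (cases p) (simp add: qmap_def dmap_def fun_eq_iff mat_part_simps(1))

lemma qmap_ad: "qmap (ad poincare (block 0 x)) = ad o4 (x :: 'a::field^4^4)"
  by (simp add: qmap_def ad_def fun_eq_iff brk_poincare_block mat_part_simps(1))

lemma short_exact_Der_poincare:
  assumes two: "(2::'a::field) \<noteq> 0"
  shows "short_exact scal_vec (Der poincare) (Der o4)
    (dmap :: 'a \<times> ('a^4) \<Rightarrow> 'a mat5 \<Rightarrow> 'a mat5) qmap"
  unfolding short_exact_def
proof (intro conjI lie_mono_dmap lie_hom_qmap)
  show "dmap ` carr scal_vec = {d \<in> carr (Der (poincare :: ('a, 'a mat5) lie_alg)). qmap d = 0}"
    using dmap_Der qmap_dmap qmap_kernel by (auto simp: scal_vec_def)
  have "\<alpha> \<in> qmap ` carr (Der poincare)" if \<alpha>: "\<alpha> \<in> carr (Der o4)" for \<alpha> :: "'a^4^4 \<Rightarrow> 'a^4^4"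
  proof -
    obtain x where "x \<in> carr o4" "\<alpha> = ad o4 x"
      using Der_o4_inner [OF two \<alpha>] .
    then show ?thesis
      by (intro image_eqI [of _ _ "ad poincare (block 0 x)"])
        (simp_all add: qmap_ad ad_Der lie_algebra_poincare)
  qed
  then show "qmap ` carr (Der (poincare :: ('a, 'a mat5) lie_alg)) = carr (Der o4)"
    using qmap_Der by blast
qed

text \<open>As the kernel of \<open>qmap\<close>, the range is an ideal. Brackets in K x K^4 have
  scalar coordinate 0, and elements with scalar coordinate 0 commute, so the second derived term
  vanishes.\<close>

lemma solvable_ideal_range_dmap:
  "solvable_ideal (Der poincare) (range (dmap :: 'a::field \<times> ('a^4) \<Rightarrow> 'a mat5 \<Rightarrow> 'a mat5))"
proof -
  let ?D = "Der poincare :: ('a, 'a mat5 \<Rightarrow> 'a mat5) lie_alg"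
  interpret D: lie_algebra ?D by (rule lie_algebra_Der [OF lie_algebra_poincare])
  interpret C: lie_algebra "Der o4 :: ('a, 'a^4^4 \<Rightarrow> 'a^4^4) lie_alg"
    by (rule lie_algebra_Der [OF lie_algebra_o4])
  have carr: "carr (scal_vec :: ('a, 'a \<times> ('a^4)) lie_alg) = UNIV"
    by (simp add: scal_vec_def)
  have d: "dmap p + dmap q = dmap (p + q)" "scl ?D c (dmap p) = dmap (scl scal_vec c p)"
    "brk ?D (dmap p) (dmap q) = dmap (brk scal_vec p q)" for c and p q :: "'a \<times> ('a^4)"
    using lie_mono_dmap [where 'a = 'a] by (simp_all add: lie_mono_def lie_hom_def linear_map_on_def carr
        del: split_paired_All)
  have d0: "dmap 0 = (0 :: 'a mat5 \<Rightarrow> 'a mat5)"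
    using d(1) [of 0 0] by simp
  have "lie_ideal (Der o4) {0 :: 'a^4^4 \<Rightarrow> 'a^4^4}"
    by (simp add: lie_ideal_def C.carr_0 C.brk_zero_right)
  then have "lie_ideal ?D {d \<in> carr ?D. qmap d \<in> {0}}"
    by (rule lie_ideal_vimage [OF lie_hom_qmap])
  moreover have "{d \<in> carr ?D. qmap d \<in> {0}} = range dmap"
    using dmap_Der qmap_dmap qmap_kernel by auto
  ultimately have ideal: "lie_ideal ?D (range dmap)"
    by simp
  let ?V = "range (\<lambda>v. dmap (0, v)) :: ('a mat5 \<Rightarrow> 'a mat5) set"
  have sub: "D.subspace ?V"
  proof (rule D.subspaceI)
    show "0 \<in> ?V"
      using d0 by (auto simp: zero_prod_def)
  qed (auto simp: d scal_vec_def)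
  have "brk ?D (dmap p) (dmap q) \<in> ?V" for p q :: "'a \<times> ('a^4)"
    by (cases p; cases q) (simp add: d scal_vec_def)
  then have "{brk ?D x y | x y. x \<in> range dmap \<and> y \<in> range dmap} \<subseteq> ?V"
    by blast
  then have V: "derived_series ?D (range dmap) 1 \<subseteq> ?V"
    using D.span_minimal [OF _ sub] by simp
  have "brk ?D (dmap (0, v)) (dmap (0, w)) = 0" for v w :: "'a^4"
    using d0 by (simp add: d scal_vec_def zero_prod_def)
  then have "{brk ?D x y | x y. x \<in> derived_series ?D (range dmap) 1 \<and>
      y \<in> derived_series ?D (range dmap) 1} \<subseteq> {0}"
    using V by blast
  then have "derived_series ?D (range dmap) (Suc 1) \<subseteq> {0}"
    unfolding derived_series.simps by (rule D.span_minimal) simp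
  moreover have "0 \<in> derived_series ?D (range dmap) (Suc 1)"
    by (simp add: D.span_zero)
  ultimately have "derived_series ?D (range dmap) (Suc 1) = {0}"
    by blast
  with ideal show ?thesis
    unfolding solvable_ideal_def by blast
qed

section \<open>Solvable ideals of the derivation algebra, in every characteristic\<close>

lemma lie_hom_block: "lie_hom o4 poincare (block 0 :: 'a::field^4^4 \<Rightarrow> 'a mat5)"
  by (simp add: lie_hom_def linear_map_on_def lie_algebra_o4 lie_algebra_poincare block_add
      block_scl brk_poincare_block)

text \<open>The Leibniz rule for d, read as an identity of maps. It shows that an ideal of
  \<open>Der L\<close> containing d also contains, up to sign, the inner derivations of all d
  x.\<close>

lemma brk_Der_ad:
  assumes "lie_algebra L" "d \<in> carr (Der L)" "x \<in> carr L"
  shows "brk (Der L) d (ad L x) = ad L (d x)"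
proof
  interpret lie_algebra L by fact
  show "brk (Der L) d (ad L x) y = ad L (d x) y" for y
    using assms(2,3) Der_0 [OF assms(1,2)]
    by (cases "y \<in> carr L") (simp_all add: Der_iff Der_simps ad_def brk_closed brk_zero_right)
qed

text \<open>In characteristic 2 the diagonal matrix units E_aa lie in \<open>o4\<close>, and the
  double commutator of y with E_bb and E_aa isolates its entry (a, b) as a multiple of
  \<open>skew_unit a b\<close>. An ideal consisting of diagonal matrices only would contain only
  scalars, by brackets with \<open>skew_unit a 1\<close>. From one elementary matrix all others are
  reached by changing one index at a time.\<close>

lemma o4_ideal_contains_skew_unit:
  fixes J :: "('a::field^4^4) set"
  assumes two: "(2::'a) = 0" and J: "lie_ideal o4 J" and x: "x \<in> J" and scalar: "\<And>c. x \<noteq> mat c"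
  shows "skew_unit i j \<in> J"
proof -
  interpret o4: lie_algebra "o4 :: ('a, 'a^4^4) lie_alg" by (rule lie_algebra_o4)
  have J': "J \<subseteq> carr o4" "o4.subspace J" "\<And>x y. \<lbrakk>x \<in> carr o4; y \<in> J\<rbrakk> \<Longrightarrow> brk o4 x y \<in> J"
    using J by (auto simp: lie_ideal_def)
  have neg: "- a = a" for a :: 'a
    using mult_2 [of a] two by (simp add: neg_eq_iff_add_eq_0)
  have off_diag: "skew_unit a b \<in> J" if y: "y \<in> J" and ab: "a \<noteq> b" and ne: "y $ a $ b \<noteq> 0" for y a b
  proof -
    define D :: "4 \<Rightarrow> 'a^4^4" where "D i = (\<chi> k l. if k = i \<and> l = i then 1 else 0)" for i
    have D: "D i \<in> carr o4" for i
      by (auto simp: o4_iff D_def neg)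
    have brk_D: "brk o4 (D i) M $ k $ l = (if k = i then M $ i $ l else 0) - (if l = i then M $ k $ i else 0)"
      for i k l and M :: "'a^4^4"
      by (cases "k = i"; cases "l = i") (simp_all add: o4_simps D_def matrix_matrix_mult_def
          mult_delta_left mult_delta_right)
    have sym: "y $ k $ l = y $ l $ k" for k l
    proof -
      have "y $ k $ l = - (y $ l $ k)"
        using y J'(1) o4_iff by blast
      then show ?thesis
        by (simp only: neg)
    qed
    have "brk o4 (D a) (brk o4 (D b) y) = scl o4 (y $ a $ b) (skew_unit a b)"
      using ab by (auto simp: vec_eq_iff brk_D o4_simps(2) skew_unit_component neg sym [of b a])
    moreover have "brk o4 (D a) (brk o4 (D b) y) \<in> J"
      using J'(3) D y by blast
    ultimately have "scl o4 (y $ a $ b) (skew_unit a b) \<in> J"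
      by simp
    then have "scl o4 (1 / y $ a $ b) (scl o4 (y $ a $ b) (skew_unit a b)) \<in> J"
      by (rule o4.subspace_scale [OF J'(2)])
    then show ?thesis
      using ne by simp
  qed
  have "\<exists>y\<in>J. \<exists>a b. a \<noteq> b \<and> y $ a $ b \<noteq> 0"
  proof (rule ccontr)
    assume "\<not> ?thesis"
    then have diag: "y $ a $ b = 0" if "y \<in> J" "a \<noteq> b" for y a b
      using that by blast
    have "x $ a $ a = x $ 1 $ 1" for a
    proof (cases "a = 1")
      case False
      have "brk o4 (skew_unit a 1) x $ a $ 1 = 0"
        using diag J'(3) x False by simp
      then show ?thesis
        using False by (simp add: brk_skew_unit_component)
    qed simp
    then have "x = mat (x $ 1 $ 1)"
      using diag x by (simp add: vec_eq_iff mat_def)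
    with scalar show False
      by blast
  qed
  then obtain a b where ab: "a \<noteq> b" "skew_unit a b \<in> J"
    using off_diag by blast
  have step: "skew_unit l k \<in> J" if "skew_unit k l \<in> J" for k l
    using o4.subspace_neg [OF J'(2) that] by (simp add: skew_unit_swap [of l k])
  have move: "skew_unit k m \<in> J" if "skew_unit k l \<in> J" "k \<noteq> l" "k \<noteq> m" for k l m
  proof (cases "l = m")
    case False
    have "brk o4 (skew_unit m l) (skew_unit k l) = (skew_unit k m :: 'a^4^4)"
      using that False by (auto simp: vec_eq_iff brk_skew_unit_component skew_unit_component neg)
    then show ?thesis
      using J'(3) [OF skew_unit_o4 that(1), of m l] by simp
  qed (use that in simp)
  show ?thesis
  proof (cases "i = j")
    case True
    then have "skew_unit i j = (0 :: 'a^4^4)"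
      by (simp add: skew_unit_def vec_eq_iff)
    then show ?thesis
      using o4.subspace_0 [OF J'(2)] by simp
  next
    case False
    \<comment> \<open>The index pairs run through (a, b), (a, k), (k, i), (i, j); k avoids a, i and
      j so that no pair on the way has equal indices.\<close>
    obtain k where k: "k \<noteq> a" "k \<noteq> i" "k \<noteq> j"
      using fourth_index by blast
    have "skew_unit k a \<in> J"
      using step [OF move [OF ab(2) ab(1) k(1) [symmetric]]] .
    then have "skew_unit k i \<in> J"
      using move [OF _ k(1,2)] by simp
    then show ?thesis
      using move [OF step _ False] k(2) by simp
  qed
qed

text \<open>The condition on x fits both cases: where 2 is nonzero, the only scalar matrix in
  \<open>o4\<close> is 0. S is a set of basis vectors, each a single bracket of two others, which is
  the form needed for \<open>perfect_subset_derived_series\<close>.\<close>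

lemma o4_ideal_contains_perfect:
  fixes J :: "('a::field^4^4) set"
  assumes J: "lie_ideal o4 J" and x: "x \<in> J" and scalar: "\<And>c. x \<noteq> mat c"
  obtains S where "S \<subseteq> J" "S \<subseteq> {brk o4 x y | x y. x \<in> S \<and> y \<in> S}" "\<not> S \<subseteq> {0}"
proof (cases "(2::'a) = 0")
  case True
  let ?S = "{skew_unit i j :: 'a^4^4 | i j. i \<noteq> j}"
  have "?S \<subseteq> J"
    using o4_ideal_contains_skew_unit [OF True J x scalar] by blast
  moreover have "?S \<subseteq> {brk o4 x y | x y. x \<in> ?S \<and> y \<in> ?S}"
  proof
    fix s :: "'a^4^4" assume "s \<in> ?S"
    then obtain i j where s: "s = skew_unit i j" "i \<noteq> j"
      by blast
    obtain k where k: "k \<noteq> i" "k \<noteq> j"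
      using fourth_index by blast
    then have "s = brk o4 (skew_unit i k) (skew_unit k j)"
      using s by (auto simp: vec_eq_iff brk_skew_unit_component skew_unit_component)
    moreover have "skew_unit i k \<in> ?S" "skew_unit k j \<in> ?S"
      using k by blast+
    ultimately show "s \<in> {brk o4 x y | x y. x \<in> ?S \<and> y \<in> ?S}"
      by blast
  qed
  moreover have "\<not> ?S \<subseteq> {0}"
  proof
    assume "?S \<subseteq> {0}"
    moreover have "(skew_unit 1 2 :: 'a^4^4) \<in> ?S"
      by (intro CollectI exI [of _ 1] exI [of _ 2]) simp
    ultimately have "(skew_unit 1 2 :: 'a^4^4) = 0"
      by blast
    then have "(skew_unit 1 2 :: 'a^4^4) $ 1 $ 2 = 0"
      by simp
    then show False
      by (simp add: skew_unit_component)
  qed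
  ultimately show thesis
    by (rule that)
next
  case two: False
  have "x \<noteq> 0"
    using scalar [of 0] by simp
  then obtain s where s: "s = 1 \<or> s = - 1" and J: "\<And>p q r. so3 s p q r \<in> J"
    using o4_ideal_contains_so3 [OF two J x] by blast
  let ?S = "{so3 s 1 0 0, so3 s 0 1 0, so3 s 0 0 1}"
  have "so3 s 1 0 0 = brk o4 (so3 s 0 1 0) (so3 s 0 0 1)"
    "so3 s 0 1 0 = brk o4 (so3 s 0 0 1) (so3 s 1 0 0)"
    "so3 s 0 0 1 = brk o4 (so3 s 1 0 0) (so3 s 0 1 0)"
    by (simp_all add: brk_so3_same [OF two s])
  then have "?S \<subseteq> {brk o4 x y | x y. x \<in> ?S \<and> y \<in> ?S}"
    by blast
  moreover have "so3 s 1 0 0 \<noteq> so3 s 0 0 0"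
    by (simp add: so3_eq_iff [OF two s])
  ultimately show thesis
    using J by (intro that [of ?S]) (auto simp: so3_0)
qed

text \<open>In characteristic 2 a derivation of \<open>o4\<close> with scalar values is not excluded
  by \<open>o4\<close> alone, where scalars are central. On the translations, however, scalars act
  nontrivially, and compatibility with the action of d there forces the values to be 0.\<close>

lemma qmap_scalar_eq_0:
  fixes d :: "'a::field mat5 \<Rightarrow> 'a mat5"
  assumes d: "d \<in> carr (Der poincare)" and scalar: "\<And>x. x \<in> carr o4 \<Longrightarrow> \<exists>c. qmap d x = mat c"
  shows "qmap d = 0"
proof -
  interpret o4: lie_algebra "o4 :: ('a, 'a^4^4) lie_alg" by (rule lie_algebra_o4)
  have "qmap d x = 0" if x: "x \<in> carr o4" for x
  proof -
    define f where "f x = qmap d x $ 1 $ 1" for x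
    define g where "g v = row_part (d (block v 0))" for v
    have f: "qmap d x = mat (f x)" if x: "x \<in> carr o4" for x
    proof -
      obtain c where "qmap d x = mat c"
        using scalar [OF x] by blast
      moreover from this have "f x = c"
        by (simp add: f_def mat_def)
      ultimately show ?thesis
        by simp
    qed
    have V: "block v 0 \<in> carr (poincare :: ('a, 'a mat5) lie_alg)" for v
      by (simp add: o4.carr_0)
    have dV: "d (block v 0) = block (g v) 0" for v
    proof -
      have "d (block v 0) \<in> carr poincare"
        using d V by (simp add: Der_iff)
      then show ?thesis
        using poincare_parts(2) [of "d (block v 0)"] Der_poincare_translation_mat_part [OF d, of v]
        by (simp add: g_def)
    qed
    have add: "g (u + v) = g u + g v" for u v
    proof -
      have "block (u + v) 0 = block u 0 + block v (0 :: 'a^4^4)"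
        by (simp add: block_add)
      then show ?thesis
        using d V by (simp add: g_def Der_iff row_part_simps)
    qed
    have scl: "g (a *s v) = a *s g v" for a v
    proof -
      have "block (a *s v) 0 = scl poincare a (block v (0 :: 'a^4^4))"
        by (simp add: block_scl)
      then show ?thesis
        using d V by (simp add: g_def Der_iff row_part_simps)
    qed
    have key: "g (v v* x) = f x *s v + g v v* x" if x: "x \<in> carr o4" for x v
    proof -
      have X: "block 0 x \<in> carr (poincare :: ('a, 'a mat5) lie_alg)"
        using x by simp
      have dX: "d (block 0 x) \<in> carr poincare"
        using d X by (simp add: Der_iff)
      have "mat_part (d (block 0 x)) = mat (f x)"
        using qmap_mat_part [OF d X] f [OF x] by simp
      then obtain w where w: "d (block 0 x) = block w (mat (f x))"
        using poincare_parts(2) [OF dX] by metis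
      have "brk poincare (block v 0) (block 0 x) = block (v v* x) 0"
        using x by (simp add: brk_poincare_block o4.brk_zero_left)
      then have "d (block (v v* x) 0)
          = brk poincare (d (block v 0)) (block 0 x) + brk poincare (block v 0) (d (block 0 x))"
        using d X V [of v] unfolding Der_iff by metis
      then have "block (g (v v* x)) 0 = block (g v v* x + v v* mat (f x)) (0 :: 'a^4^4)"
        using x by (simp add: dV w brk_poincare_block block_add o4.brk_zero_left brk_o4_mat)
      moreover have "v v* mat (f x) = f x *s v"
        by (simp add: vec_eq_iff vector_matrix_mult_def mat_def mult_delta_left mult_delta_right)
      ultimately show ?thesis
        by (simp add: add.commute)
    qed
    have g0: "g 0 = 0"
      using add [of 0 0] by simp
    \<comment> \<open>On a coordinate vector e_k killed by \<open>skew_unit i j\<close>, the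
      coordinate k of \<open>key\<close> retains nothing but the scalar.\<close>
    have f_unit: "f (skew_unit i j) = 0" for i j
    proof -
      obtain k where k: "k \<noteq> i" "k \<noteq> j"
        using fourth_index by blast
      have "axis k 1 v* skew_unit i j = (0 :: 'a^4)"
        using k by (simp add: vec_eq_iff vec_mult_skew_unit axis_def)
      then have "(f (skew_unit i j) *s axis k 1 + g (axis k 1) v* skew_unit i j) $ k = 0"
        using key [OF skew_unit_o4, of "axis k 1" i j] g0 by simp
      then show ?thesis
        using k by (simp add: vec_mult_skew_unit)
    qed
    obtain l where l: "\<And>v. g v = l *s v"
      using o4_equivariant_scalar [of g] add scl key [OF skew_unit_o4] f_unit by auto
    \<comment> \<open>Once g is multiplication by l, the terms with g in \<open>key\<close> cancel.
      This reaches every x in \<open>o4\<close>, including those outside the span of the elementary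
      matrices.\<close>
    have "f x *s axis 1 1 = 0"
      using key [OF x, of "axis 1 1"] by (simp add: l scalar_vector_matrix_assoc)
    then have "(f x *s axis 1 1) $ 1 = 0"
      by simp
    then show ?thesis
      using f [OF x] by simp
  qed
  moreover have "qmap d x = 0" if "x \<notin> carr o4" for x
    using qmap_Der [OF d] that by (simp add: Der_iff)
  ultimately show ?thesis
    by (intro ext) (metis zero_fun_apply)
qed

lemma solvable_ideal_subset_range_dmap:
  fixes I :: "('a::field mat5 \<Rightarrow> 'a mat5) set"
  assumes I: "solvable_ideal (Der poincare) I"
  shows "I \<subseteq> range dmap"
proof
  let ?D = "Der poincare :: ('a, 'a mat5 \<Rightarrow> 'a mat5) lie_alg"
  \<comment> \<open>Ideals are pushed forward along surjections, and q is known to reach all of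
    \<open>Der o4\<close> only where 2 is nonzero; so the target is cut down to the image.\<close>
  let ?C = "Der o4 \<lparr>carr := qmap ` carr ?D\<rparr>"
  interpret D: lie_algebra ?D by (rule lie_algebra_Der [OF lie_algebra_poincare])
  fix d assume d: "d \<in> I"
  have ideal: "lie_ideal ?D I" and sub: "I \<subseteq> carr ?D"
    and subspace: "D.subspace I" and brk: "\<And>x y. \<lbrakk>x \<in> carr ?D; y \<in> I\<rbrakk> \<Longrightarrow> brk ?D x y \<in> I"
    using I by (auto simp: solvable_ideal_def lie_ideal_def)
  obtain n where n: "derived_series ?D I n = {0}"
    using I by (auto simp: solvable_ideal_def)
  have dD: "d \<in> carr ?D"
    using d sub by blast
  have "lie_hom o4 ?C (qmap \<circ> (ad poincare \<circ> block 0))"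
    by (rule lie_hom_comp [OF lie_hom_comp [OF lie_hom_block lie_hom_ad [OF lie_algebra_poincare]]
      lie_hom_image(2) [OF lie_hom_qmap]])
  moreover have "qmap \<circ> (ad poincare \<circ> block 0) = ad (o4 :: ('a, 'a^4^4) lie_alg)"
    by (simp add: fun_eq_iff [where f = "_ \<circ> _"] qmap_ad)
  ultimately have ad: "lie_hom o4 ?C (ad o4)"
    by simp
  let ?J = "{x \<in> carr o4. ad o4 x \<in> qmap ` I}"
  have "lie_ideal ?C (qmap ` I)"
    by (rule lie_ideal_image [OF lie_hom_image(2) [OF lie_hom_qmap] _ ideal]) simp
  then have J: "lie_ideal o4 ?J"
    by (rule lie_ideal_vimage [OF ad])
  have J_scalar: "\<exists>c. x = mat c" if x: "x \<in> ?J" for x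
  proof (rule ccontr)
    assume "\<nexists>c. x = mat c"
    then have not_scalar: "\<And>c. x \<noteq> mat c"
      by blast
    obtain S where S: "S \<subseteq> ?J" "S \<subseteq> {brk o4 x y | x y. x \<in> S \<and> y \<in> S}" "\<not> S \<subseteq> {0}"
      using o4_ideal_contains_perfect [OF J x not_scalar] .
    have S_o4: "S \<subseteq> carr o4"
      using S(1) by blast
    have ad_brk: "ad o4 (brk o4 x y) = brk (Der o4) (ad o4 x) (ad o4 y)" if "x \<in> S" "y \<in> S" for x y
      using lie_hom_ad [OF lie_algebra_o4] that S_o4 by (auto simp: lie_hom_def)
    have "ad o4 ` S \<subseteq> {brk (Der o4) x y | x y. x \<in> ad o4 ` S \<and> y \<in> ad o4 ` S}"
    proof
      fix t assume "t \<in> ad o4 ` S"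
      then obtain x y where "x \<in> S" "y \<in> S" "t = ad o4 (brk o4 x y)"
        using S(2) by blast
      then show "t \<in> {brk (Der o4) x y | x y. x \<in> ad o4 ` S \<and> y \<in> ad o4 ` S}"
        using ad_brk by blast
    qed
    moreover have "ad o4 ` S \<subseteq> qmap ` I"
      using S(1) by blast
    ultimately have "ad o4 ` S \<subseteq> qmap ` derived_series ?D I n"
      by (intro perfect_subset_derived_series [OF lie_hom_qmap sub])
    also have "\<dots> = {0}"
      by (simp add: n qmap_def fun_eq_iff mat_part_simps(1))
    finally have ad_S: "ad o4 ` S \<subseteq> {0}" .
    \<comment> \<open>Every element of S is a bracket of elements of S, so vanishing of these
      brackets leaves S no nonzero element.\<close>
    have "brk o4 x y = 0" if "x \<in> S" "y \<in> S" for x y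
    proof -
      have "ad o4 x = 0"
        using ad_S that by blast
      then have "ad o4 x y = 0"
        by simp
      then show ?thesis
        using that S_o4 by (auto simp: ad_def split: if_splits)
    qed
    then show False
      using S(2,3) by blast
  qed
  have "\<exists>c. qmap d x = mat c" if x: "x \<in> carr o4" for x
  proof -
    have X: "block 0 x \<in> carr (poincare :: ('a, 'a mat5) lie_alg)"
      using x by simp
    then have dX: "d (block 0 x) \<in> carr poincare"
      using dD by (simp add: Der_iff)
    note adX = ad_Der [OF lie_algebra_poincare X]
    \<comment> \<open>Up to sign, the ideal I contains [d, ad X] = ad(d X); its image under q is the
      inner derivation of q(d)(x), so q(d)(x) lies in J.\<close>
    have "brk ?D d (ad poincare (block 0 x)) = - brk ?D (ad poincare (block 0 x)) d"
      by (rule D.brk_anticomm [OF adX dD])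
    then have "ad poincare (d (block 0 x)) \<in> I"
      using D.subspace_neg [OF subspace brk [OF adX d]] brk_Der_ad [OF lie_algebra_poincare dD X]
      by simp
    moreover have "qmap (ad poincare (d (block 0 x))) = ad o4 (mat_part (d (block 0 x)))"
    proof -
      obtain w y where "d (block 0 x) = block w y" "y \<in> carr o4"
        using dX by (rule poincareE)
      then show ?thesis
        by (simp add: qmap_def ad_def fun_eq_iff brk_poincare_block mat_part_simps(1))
    qed
    ultimately have "mat_part (d (block 0 x)) \<in> ?J"
      using poincare_parts(1) [OF dX] by (metis (mono_tags, lifting) imageI mem_Collect_eq)
    then show ?thesis
      using J_scalar by (simp add: qmap_def)
  qed
  then show "d \<in> range dmap"
    using qmap_kernel [OF dD] qmap_scalar_eq_0 [OF dD] by blast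
qed

text \<open>Characteristic 2 is included on purpose: in the theorem below, the field of the clause on the
  radical is an independent type variable, to which the assumption does not apply.\<close>

lemma is_radical_range_dmap:
  "is_radical (Der poincare) (range (dmap :: 'a::field \<times> ('a^4) \<Rightarrow> 'a mat5 \<Rightarrow> 'a mat5))"
  using solvable_ideal_range_dmap solvable_ideal_subset_range_dmap by (auto simp: is_radical_def)

theorem proposition9:
  assumes "CHAR('a::alg_closed_field) \<noteq> 2"
  shows
    "short_exact scal_vec (Der poincare) (Der o4)
       (dmap :: 'a \<times> ('a^4) \<Rightarrow> 'a mat5 \<Rightarrow> 'a mat5) qmap \<and>
     (\<exists>j :: ('a^4^4 \<Rightarrow> 'a^4^4) \<Rightarrow> 'a mat5 \<Rightarrow> 'a mat5.
        lie_mono (Der o4) (Der poincare) j \<and>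
        (\<forall>x0\<in>carr o4. \<forall>v. \<forall>x\<in>carr o4.
           j (ad o4 x0) (block v x) = block (- (v v* x0)) (ad o4 x0 x)) \<and>
        (\<forall>\<alpha>\<in>carr (Der o4). qmap (j \<alpha>) = \<alpha>) \<and>
        (\<forall>d\<in>carr (Der poincare).
           \<exists>!p. fst p \<in> carr (Der o4) \<and> d = j (fst p) + dmap (snd p)) \<and>
        is_radical (Der poincare) (range dmap) \<and>
        lie_isomorphic (Der poincare \<lparr>carr := range dmap\<rparr>) (scal_vec :: ('a, 'a \<times> ('a^4)) lie_alg) \<and>
        direct_sum_of (Der poincare) (range dmap) (j ` carr (Der o4)) \<and>
        lie_isomorphic (Der poincare \<lparr>carr := j ` carr (Der o4)\<rparr>)
          (lie_prod sl2 sl2 :: ('a, ('a^2^2) \<times> ('a^2^2)) lie_alg))"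
proof -
  let ?ad = "ad (o4 :: ('a, 'a^4^4) lie_alg)"
  have "CHAR('a) \<noteq> 1"
    using of_nat_eq_0_iff_char_dvd [where 'a = 'a, of 1] by auto
  then have "\<not> CHAR('a) dvd 2"
    using assms by (metis two_is_prime_nat prime_nat_iff)
  then have two: "(2::'a) \<noteq> 0"
    using of_nat_eq_0_iff_char_dvd [where 'a = 'a, of 2] by simp
  obtain i :: 'a where i: "i * i = - 1"
    using nth_root_exists [of 2 "- 1 :: 'a"] by (auto simp: power2_eq_square)
  note ex = short_exact_Der_poincare [OF two]
  have ad: "lie_hom o4 (Der o4) ?ad" "bij_betw ?ad (carr o4) (carr (Der o4))"
    using lie_hom_ad [OF lie_algebra_o4] bij_betw_ad_o4 [OF two] by auto
  \<comment> \<open>The inverse of \<open>ad\<close> is meaningful because \<open>ad\<close> is a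
    bijection from \<open>o4\<close> onto its derivations in this characteristic; so j sends ad(x)
    to ad of the block matrix with translation part 0 and matrix part x.\<close>
  define j :: "('a^4^4 \<Rightarrow> 'a^4^4) \<Rightarrow> 'a mat5 \<Rightarrow> 'a mat5"
    where "j = ad poincare \<circ> (block 0 \<circ> inv_into (carr o4) ?ad)"
  have j_ad: "j (ad o4 x) = ad poincare (block 0 x)" if "x \<in> carr o4" for x
    using that ad(2) by (simp add: j_def bij_betw_def)
  have qj: "\<forall>\<alpha>\<in>carr (Der o4). qmap (j \<alpha>) = \<alpha>"
    using j_ad Der_o4_inner [OF two] by (metis qmap_ad)
  have "lie_hom (Der o4) (Der poincare) j"
    unfolding j_def
    by (rule lie_hom_comp [OF lie_hom_comp [OF lie_hom_inv_into [OF ad] lie_hom_block]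
        lie_hom_ad [OF lie_algebra_poincare]])
  then have j: "lie_mono (Der o4) (Der poincare) j"
    by (auto simp: lie_mono_def intro: inj_on_inverseI bspec [OF qj])
  \<comment> \<open>The minus sign is that of the bracket of p: the translation part of the bracket
    of (0, x0) with (v, x) is 0 x - v x0.\<close>
  have j_block: "j (ad o4 x0) (block v x) = block (- (v v* x0)) (ad o4 x0 x)"
    if "x0 \<in> carr o4" "x \<in> carr o4" for x0 x v
    using that unfolding j_ad [OF that(1)] by (simp add: ad_def brk_poincare_block)
  have decomp: "\<exists>!p. fst p \<in> carr (Der o4) \<and> d = j (fst p) + dmap (snd p)"
    if "d \<in> carr (Der poincare)" for d
    using split_exact_decomp [OF ex j, OF qj that] by (simp add: scal_vec_def)
  have sum: "direct_sum_of (Der poincare) (range dmap) (j ` carr (Der o4))"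
    using split_exact_direct_sum [OF ex j, OF qj] by (simp add: scal_vec_def)
  have radical_iso: "lie_isomorphic (Der poincare \<lparr>carr := range dmap\<rparr>)
      (scal_vec :: ('a, 'a \<times> ('a^4)) lie_alg)"
    using lie_isomorphic_sym [OF lie_isomorphic_image [OF lie_mono_dmap [where 'a = 'a]]]
    by (simp add: scal_vec_def)
  have "lie_isomorphic (lie_prod sl2 sl2 :: ('a, ('a^2^2) \<times> ('a^2^2)) lie_alg)
      (Der poincare \<lparr>carr := j ` carr (Der o4)\<rparr>)"
    by (rule lie_isomorphic_trans [OF lie_isomorphic_trans [OF lie_isomorphic_sl2_sl2_o4 [OF two i]
      _] lie_isomorphic_image [OF j]]) (use ad in \<open>auto simp: lie_isomorphic_def\<close>)
  note complement_iso = lie_isomorphic_sym [OF this]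
  show ?thesis
    using ex j j_block bspec [OF qj] decomp is_radical_range_dmap radical_iso sum complement_iso
    by (intro conjI exI [of _ j] ballI allI)
qed

end
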